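(* There is an absolute constant $C>0$ such that the following holds. Let $\mathcal{L}\subset\mathbb{R}^n$ be a lattice, $\vec t\in\mathbb{R}^n$, $s>0$, $M$ an integer and $\kappa\ge C\log M$. If $\vec X_1,\dots,\vec X_M$ are sampled independently from $D_{\mathcal{L}-\vec t,s}$ with \[ M\ge 10\kappa^2\cdot\frac{\rho_s(\mathcal{L}-\vec t)}{\max_{\vec c\in\mathcal{L}/(2\mathcal{L})}\rho_s(2\mathcal{L}+\vec c-\vec t)}, \] then the output of Pair\_and\_Average applied to the $\vec X_i$ is a mixture of independent Gaussians over $\mathcal{L}-\vec t$ with parameter $s/\sqrt2$ that, up to statistical distance $\exp(-\Omega(\kappa))$, dominates the distribution of \[ M' := \left\lceil \frac{M}{32\kappa}\cdot\frac{\rho_{s/\sqrt2}(\mathcal{L}-\vec t)\cdot\rho_{s/\sqrt2}(\mathcal{L})}{\rho_s(\mathcal{L}-\vec t)\cdot\max_{\vec d\in\mathcal{L}/(2\mathcal{L})}\rho_s(2\mathcal{L}+\vec d-\vec t)}\right\rceil \] independent samples from $D_{\mathcal{L}-\vec t,s/\sqrt2}$.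
   Context: A lattice $\mathcal{L}\subset\mathbb{R}^n$ is the set of integer combinations of $n$ linearly independent vectors; $\mathcal{L}/(2\mathcal{L})$ is the set of cosets of $2\mathcal{L}$ in $\mathcal{L}$. $\rho_s(\vec{x}) := \exp(-\pi\|\vec{x}\|^2/s^2)$, $\rho_s(A):=\sum_{\vec a\in A}\rho_s(\vec a)$, and $D_{A,s}$ is the distribution on the shifted lattice $A$ with probabilities $\rho_s(\vec a)/\rho_s(A)$. $\Omega(\cdot)$ hides absolute constants. Pair\_and\_Average: given a list $\vec X_1,\dots,\vec X_M\in\mathcal{L}-\vec t$, for each still-unpaired $\vec X_i$ in order, if there is another unpaired $\vec X_j$ with $\vec X_j\equiv\vec X_i\bmod 2\mathcal{L}$, pair them and add $(\vec X_i+\vec X_j)/2$ to the output. Domination: for a finite set $S=\{1,\dots,N\}$ and random finite lists $(X_1,\dots,X_M)$, $(X'_1,\dots,X'_{M'})$ over $S$, the first dominates the second if for every $(k_1,\dots,k_N)\in\mathbb{N}^N$, $\Pr[|\{j:X_j=i\}|\ge k_i\ \forall i]\ge\Pr[|\{j:X'_j=i\}|\ge k_i\ \forall i]$. Mixture of independent Gaussians over $\mathcal{L}-\vec t$ with parameter $s$: a random finite list $(\vec X_1,\dots,\vec X_M)$ in $\mathcal{L}-\vec t$ such that, conditioned on any assignment of cosets $\vec X_i\in2\mathcal{L}+\vec c_i$, the $\vec X_i$ are independent with $\vec X_i\sim D_{2\mathcal{L}+\vec c_i,s}$; its coset distribution is $(2\mathcal{L}+\vec X_1,\dots,2\mathcal{L}+\vec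 X_M)$, and one mixture dominates another (or a list of i.i.d. discrete Gaussian samples, which is also such a mixture) if its coset distribution dominates the other's. "Dominates up to statistical distance $\delta$" means it dominates some random list whose distribution is within statistical distance $\delta$ of the stated one. *)

theory Defs
  imports
    "HOL-Probability.Probability"
    "HOL-Library.Landau_Symbols"
    "Jordan_Normal_Form.VS_Connect"
begin

(* Vectors of R^n are elements of carrier_vec n, where n is a natural number and not a type:
   an absolute constant must be chosen before the dimension, so the dimension has to be
   quantifiable inside a formula. *)

section \<open>Lattices and their cosets\<close>

definition is_lattice :: "nat \<Rightarrow> real vec set \<Rightarrow> bool" where
  "is_lattice n L \<longleftrightarrow>
     (\<exists>B \<in> carrier_mat n n.
        distinct (cols B) \<and>
        \<not> module.lin_dep class_ring (module_vec TYPE(real) n) (set (cols B)) \<and>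
        L = {B *\<^sub>v map_vec real_of_int z | z. z \<in> carrier_vec n})"

definition doubled :: "real vec set \<Rightarrow> real vec set" where
  "doubled L = (\<lambda>v. 2 \<cdot>\<^sub>v v) ` L"

definition shift_by :: "real vec set \<Rightarrow> real vec \<Rightarrow> real vec set" where
  "shift_by A t = (\<lambda>v. v - t) ` A"

(* The coset 2L + x; x may be any vector, in particular one in L - t. *)
definition coset2 :: "real vec set \<Rightarrow> real vec \<Rightarrow> real vec set" where
  "coset2 L x = (\<lambda>v. v + x) ` doubled L"

definition quotient2 :: "real vec set \<Rightarrow> real vec set set" where
  "quotient2 L = coset2 L ` L"

definition shifted_quotient2 :: "real vec set \<Rightarrow> real vec \<Rightarrow> real vec set set" where
  "shifted_quotient2 L t = (\<lambda>K. shift_by K t) ` quotient2 L"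

section \<open>Discrete Gaussians\<close>

definition rho :: "real \<Rightarrow> real vec \<Rightarrow> real" where
  "rho s x = exp (- pi * scalar_prod x x / s\<^sup>2)"

definition rho_set :: "real \<Rightarrow> real vec set \<Rightarrow> real" where
  "rho_set s A = (\<Sum>\<^sub>\<infinity>a\<in>A. rho s a)"

definition max_coset_mass :: "real vec set \<Rightarrow> real vec \<Rightarrow> real \<Rightarrow> real" where
  "max_coset_mass L t s = (MAX K\<in>quotient2 L. rho_set s (shift_by K t))"

(* Meaningful when the Gaussian sum over A converges to a positive number, as it does for
   s > 0 and A a shift of L or of 2L with L a lattice. *)
definition discrete_gaussian :: "real vec set \<Rightarrow> real \<Rightarrow> real vec pmf" where
  "discrete_gaussian A s = embed_pmf (\<lambda>x. if x \<in> A then rho s x / rho_set s A else 0)"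

section \<open>Random finite lists\<close>

primrec independent_list :: "'a pmf list \<Rightarrow> 'a list pmf" where
  "independent_list [] = return_pmf []"
| "independent_list (p # ps) =
     bind_pmf p (\<lambda>x. bind_pmf (independent_list ps) (\<lambda>xs. return_pmf (x # xs)))"

definition dominates :: "'b set \<Rightarrow> 'b list pmf \<Rightarrow> 'b list pmf \<Rightarrow> bool" where
  "dominates S P Q \<longleftrightarrow>
     (\<forall>k :: 'b \<Rightarrow> nat.
        measure_pmf.prob P {xs. \<forall>i\<in>S. count_list xs i \<ge> k i} \<ge>
        measure_pmf.prob Q {xs. \<forall>i\<in>S. count_list xs i \<ge> k i})"

definition statistical_distance :: "'b pmf \<Rightarrow> 'b pmf \<Rightarrow> real" where
  "statistical_distance P Q = (1/2) * (\<Sum>\<^sub>\<infinity>x. \<bar>pmf P x - pmf Q x\<bar>)"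

section \<open>Mixtures of independent Gaussians\<close>

definition coset_distribution :: "real vec set \<Rightarrow> real vec list pmf \<Rightarrow> real vec set list pmf" where
  "coset_distribution L P = map_pmf (map (coset2 L)) P"

definition gaussian_mixture ::
  "real vec set \<Rightarrow> real vec \<Rightarrow> real \<Rightarrow> real vec list pmf \<Rightarrow> bool" where
  "gaussian_mixture L t s P \<longleftrightarrow>
     set_pmf P \<subseteq> lists (shift_by L t) \<and>
     (\<forall>Ks \<in> set_pmf (coset_distribution L P).
        cond_pmf P {xs. map (coset2 L) xs = Ks} =
        independent_list (map (\<lambda>K. discrete_gaussian K s) Ks))"

definition mixture_dominates ::
  "real vec set \<Rightarrow> real vec \<Rightarrow> real vec list pmf \<Rightarrow> real vec list pmf \<Rightarrow> bool" where
  "mixture_dominates L t P Q \<longleftrightarrow>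
     dominates (shifted_quotient2 L t) (coset_distribution L P) (coset_distribution L Q)"

(* Domination compares mixtures, so the intermediate random list Q' is itself required to be
   a mixture, close to Q as a distribution on lists of vectors (not just of cosets). *)
definition mixture_dominates_upto ::
  "real \<Rightarrow> real vec set \<Rightarrow> real vec \<Rightarrow> real \<Rightarrow> real vec list pmf \<Rightarrow> real vec list pmf \<Rightarrow> bool" where
  "mixture_dominates_upto \<delta> L t s P Q \<longleftrightarrow>
     (\<exists>Q'. gaussian_mixture L t s Q' \<and> statistical_distance Q' Q \<le> \<delta> \<and> mixture_dominates L t P Q')"

section \<open>Pairing and averaging\<close>

(* The partner of a vector is the first later vector in its coset. An earlier vector of the
   coset that is still unpaired cannot exist: it would have been paired when its turn came. *)
function pair_and_average :: "real vec set \<Rightarrow> real vec list \<Rightarrow> real vec list" where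
  "pair_and_average L [] = []"
| "pair_and_average L (x # xs) =
     (case find (\<lambda>y. y - x \<in> doubled L) xs of
        None \<Rightarrow> pair_and_average L xs
      | Some y \<Rightarrow> (1/2) \<cdot>\<^sub>v (x + y) # pair_and_average L (remove1 y xs))"
  by pat_completeness auto
termination
  by (relation "Wellfounded.measure (\<lambda>(L, xs). length xs)") (auto simp: length_remove1)

end

theory Submission
  imports Defs "Jordan_Normal_Form.DL_Rank" "HOL-Combinatorics.Multiset_Permutations"
begin

text \<open>Among exactly \<open>M\<close> samples the coset counts are dependent, while domination
  concerns all of them at once; only independent counts can be coupled coset by coset. Both Poisson
  means err on the safe side: fewer than \<open>M\<close> inputs can only lose pairs, and a surplus
  over \<open>M'\<close> targets is cut off. The half in the coupling reflects that \<open>n\<close>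
  inputs in one coset yield \<open>n div 2\<close> pairs.

  There are 2^n cosets, a number bounded in terms of neither \<open>M\<close> nor \<kappa>. The
  failure probability of a coset must therefore be proportional to its mean \<open>a\<close>, which
  for tiny \<open>a\<close> forces an exact comparison of tails. The bound on \<open>b\<close>
  linear in \<open>a\<close> holds because \<open>M'\<close> has the maximal coset mass in its
  denominator; the quadratic one uses the lower bound on \<open>M\<close>.

  Domination speaks of the coset of an average, which is random given the coset of its two inputs.
  Domination of the input cosets passes through this randomness because further independent draws
  only raise counts. The numerator of \<open>M'\<close> is the sum of the squared coset
  masses.\<close>

text \<open>
  Given the cosets of the inputs, the average of a pair from the coset \<open>K\<close> has a law
  \<open>average_law K\<close> that is a mixture of Gaussians of parameter \<open>s / sqrt 2\<close>. If \<open>K\<close> is drawn with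
  probability proportional to the square of its mass, as for a collision of two samples, then the
  average is exactly Gaussian on the shifted lattice. So it suffices that the cosets of the pairs
  formed by the algorithm dominate independent samples from this collision law.

  Replacing \<open>M\<close> by a Poisson variable of mean \<open>M / 2\<close> and \<open>M'\<close> by one of mean \<open>2 M'\<close> makes the counts
  of distinct cosets independent Poisson variables, with means \<open>a\<close> and \<open>b\<close> where
  \<open>b \<le> a / (4 \<kappa>)\<close> and \<open>b \<le> a\<^sup>2 / (20 \<kappa>\<^sup>3)\<close>. A quantile coupling then puts the second variable below half
  of the first, except with a probability of order \<open>a exp (- \<kappa> / 8)\<close>; these sum to
  \<open>M exp (- \<kappa> / 8)\<close>, which is where \<open>\<kappa> \<ge> C log M\<close> enters. For \<open>\<kappa> < 100\<close> the rate is taken to be \<open>0\<close> and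
  the empty list is a sufficient comparison.
\<close>

section \<open>Counts of a Poisson number of samples\<close>

lemma pmf_replicate_pmf:
  "pmf (replicate_pmf n p) xs = (if length xs = n then prod_list (map (pmf p) xs) else 0)"
proof (induction n arbitrary: xs)
  case 0
  then show ?case by (auto simp: pmf_return)
next
  case (Suc n)
  show ?case
  proof (cases xs)
    case Nil
    then show ?thesis
      by (auto simp: pmf_eq_0_set_pmf)
  next
    case (Cons a ys)
    have eq: "replicate_pmf (Suc n) p = map_pmf (\<lambda>(x, xs). x # xs) (pair_pmf p (replicate_pmf n p))"
      by (simp add: pair_pmf_def map_bind_pmf map_return_pmf bind_return_pmf map_pmf_def bind_assoc_pmf)
    have inj: "inj (\<lambda>(x::'a, xs). x # xs)"
      by (auto simp: inj_def)
    have "pmf (replicate_pmf (Suc n) p) xs = pmf (pair_pmf p (replicate_pmf n p)) (a, ys)"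
      unfolding eq Cons using pmf_map_inj'[OF inj, of _ "(a, ys)"] by simp
    then show ?thesis
      using Suc[of ys] Cons by (simp add: pmf_pair)
  qed
qed

definition poisson_sample :: "real \<Rightarrow> 'a pmf \<Rightarrow> 'a list pmf" where
  "poisson_sample r p = bind_pmf (poisson_pmf r) (\<lambda>n. replicate_pmf n p)"

lemma pmf_poisson_sample:
  "pmf (poisson_sample r p) xs = pmf (poisson_pmf r) (length xs) * prod_list (map (pmf p) xs)"
proof -
  have "ennreal (pmf (poisson_sample r p) xs) =
      (\<integral>\<^sup>+n. ennreal (prod_list (map (pmf p) xs)) * indicator {length xs} n \<partial>poisson_pmf r)"
    unfolding poisson_sample_def ennreal_pmf_bind pmf_replicate_pmf
    by (intro nn_integral_cong) (auto simp: indicator_def)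
  also have "\<dots> = ennreal (prod_list (map (pmf p) xs)) * ennreal (pmf (poisson_pmf r) (length xs))"
    by (subst nn_integral_cmult) (auto simp: emeasure_pmf_single)
  also have "\<dots> = ennreal (pmf (poisson_pmf r) (length xs) * prod_list (map (pmf p) xs))"
    by (subst mult.commute, rule ennreal_mult'[symmetric]) simp
  finally show ?thesis
    by (subst (asm) ennreal_inj) (auto intro!: mult_nonneg_nonneg prod_list_nonneg)
qed

lemma count_list_eq_iff_mset: "count_list xs = count A \<longleftrightarrow> mset xs = A"
  by (simp add: multiset_eq_iff count_mset fun_eq_iff)

lemma sum_count_list_eq_length:
  assumes "finite S" "set xs \<subseteq> S"
  shows "(\<Sum>c\<in>S. count_list xs c) = length xs"
proof (use assms(2) in \<open>induction xs\<close>)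
  case (Cons a xs)
  have "(\<Sum>c\<in>S. count_list (a # xs) c) = (\<Sum>c\<in>S. count_list xs c + (if c = a then 1 else 0))"
    by (intro sum.cong) auto
  also have "\<dots> = length (a # xs)"
    using Cons assms(1) by (simp add: sum.distrib)
  finally show ?case .
qed simp

text \<open>Poisson splitting. The lists with counts \<open>k\<close> are the permutations of one
  multiset; their multinomial number cancels the factorial in the Poisson weight of the length, and
  the exponential factors because the masses of \<open>p\<close> sum to 1.\<close>

lemma poisson_sample_counts:
  fixes p :: "'a pmf"
  assumes fin: "finite (set_pmf p)" and r: "r > 0"
  shows "map_pmf count_list (poisson_sample r p) = Pi_pmf (set_pmf p) 0 (\<lambda>c. poisson_pmf (r * pmf p c))"
proof (rule pmf_eqI)
  fix k :: "'a \<Rightarrow> nat"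
  let ?S = "set_pmf p"
  have S1: "(\<Sum>c\<in>?S. pmf p c) = 1"
    using fin by (rule sum_pmf_eq_1) simp
  show "pmf (map_pmf count_list (poisson_sample r p)) k = pmf (Pi_pmf ?S 0 (\<lambda>c. poisson_pmf (r * pmf p c))) k"
  proof (cases "\<forall>c. c \<notin> ?S \<longrightarrow> k c = 0")
    case False
    have "k \<notin> set_pmf (map_pmf count_list (poisson_sample r p))"
    proof
      assume "k \<in> set_pmf (map_pmf count_list (poisson_sample r p))"
      then obtain xs n where "xs \<in> set_pmf (replicate_pmf n p)" "k = count_list xs"
        by (auto simp: poisson_sample_def)
      then have "\<forall>c. c \<notin> ?S \<longrightarrow> k c = 0"
        by (auto simp: set_replicate_pmf count_list_0_iff)
      with False show False by blast
    qed
    then have "pmf (map_pmf count_list (poisson_sample r p)) k = 0"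
      by (simp add: pmf_eq_0_set_pmf)
    moreover have "pmf (Pi_pmf ?S 0 (\<lambda>c. poisson_pmf (r * pmf p c))) k = 0"
      using False fin by (auto intro!: pmf_Pi_outside)
    ultimately show ?thesis by simp
  next
    case True
    define n where "n = (\<Sum>c\<in>?S. k c)"
    define A where "A = Abs_multiset k"
    have "finite {c. 0 < k c}"
      by (rule finite_subset[OF _ fin]) (use True in auto)
    then have kA: "k = count A"
      unfolding A_def by (simp add: Abs_multiset_inverse)
    have sub: "set_mset A \<subseteq> ?S"
    proof
      fix x assume "x \<in># A"
      then have "k x \<noteq> 0" by (simp only: kA) simp
      then show "x \<in> ?S" using True[rule_format, of x] by metis
    qed
    have size: "size A = n"
      unfolding n_def size_multiset_overloaded_eq unfolding kA
      by (rule sum.mono_neutral_left) (use sub fin in \<open>auto simp: not_in_iff\<close>)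
    have fact: "real (card (permutations_of_multiset A)) * (\<Prod>c\<in>?S. fact (k c)) = fact n"
    proof -
      have "(\<Prod>c\<in>?S. fact (k c)) = (\<Prod>x\<in>set_mset A. fact (count A x) :: real)"
        unfolding kA
        by (rule prod.mono_neutral_right) (use sub fin in \<open>auto simp: not_in_iff\<close>)
      moreover have "real (card (permutations_of_multiset A) * (\<Prod>x\<in>set_mset A. fact (count A x))) = real (fact n)"
        unfolding size[symmetric] card_permutations_of_multiset_aux ..
      ultimately show ?thesis by simp
    qed
    have pr: "prod_list (map (pmf p) xs) = (\<Prod>c\<in>?S. pmf p c ^ k c)" "length xs = n"
      if "xs \<in> permutations_of_multiset A" for xs
    proof -
      have m: "mset xs = A" using that by (simp add: permutations_of_multisetD)
      have "prod_list (map (pmf p) xs) = prod_mset (image_mset (pmf p) A)"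
        unfolding m[symmetric] by (simp flip: prod_mset_prod_list)
      also have "\<dots> = (\<Prod>c\<in>set_mset A. pmf p c ^ count A c)"
        by (rule image_prod_mset_multiplicity)
      also have "\<dots> = (\<Prod>c\<in>?S. pmf p c ^ k c)"
        unfolding kA
        by (rule prod.mono_neutral_left) (use sub fin in \<open>auto simp: not_in_iff\<close>)
      finally show "prod_list (map (pmf p) xs) = (\<Prod>c\<in>?S. pmf p c ^ k c)" .
      show "length xs = n" using m size by (metis size_mset)
    qed
    have "pmf (map_pmf count_list (poisson_sample r p)) k =
        measure (poisson_sample r p) (permutations_of_multiset A)"
      unfolding pmf_map
      by (rule arg_cong[where f = "measure _"]) (auto simp: permutations_of_multiset_def kA count_list_eq_iff_mset)
    also have "\<dots> = (\<Sum>xs\<in>permutations_of_multiset A. pmf (poisson_sample r p) xs)"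
      by (rule measure_measure_pmf_finite) simp
    also have "\<dots> = real (card (permutations_of_multiset A)) * (pmf (poisson_pmf r) n * (\<Prod>c\<in>?S. pmf p c ^ k c))"
      by (simp add: pmf_poisson_sample pr del: pmf_poisson)
    also have "\<dots> = (real (card (permutations_of_multiset A)) / fact n) * (r ^ n * exp (-r) * (\<Prod>c\<in>?S. pmf p c ^ k c))"
      using r by simp
    also have "real (card (permutations_of_multiset A)) / fact n = 1 / (\<Prod>c\<in>?S. fact (k c))"
    proof -
      have "(\<Prod>c\<in>?S. fact (k c) :: real) \<noteq> 0"
        using fin by simp
      then show ?thesis
        using fact by (simp add: field_simps)
    qed
    also have "r ^ n = (\<Prod>c\<in>?S. r ^ k c)"
      unfolding n_def by (simp add: power_sum)
    also have "exp (-r) = (\<Prod>c\<in>?S. exp (- (r * pmf p c)))"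
      using fin by (simp add: exp_sum[symmetric] sum_negf S1 flip: sum_distrib_left)
    also have "1 / (\<Prod>c\<in>?S. fact (k c)) * ((\<Prod>c\<in>?S. r ^ k c) * (\<Prod>c\<in>?S. exp (- (r * pmf p c))) * (\<Prod>c\<in>?S. pmf p c ^ k c))
       = (\<Prod>c\<in>?S. pmf (poisson_pmf (r * pmf p c)) (k c))"
    proof -
      have "pmf (poisson_pmf (r * pmf p c)) (k c) = r ^ k c * exp (- (r * pmf p c)) * pmf p c ^ k c / fact (k c)"
        if "c \<in> ?S" for c
        using that r by (simp add: pmf_positive power_mult_distrib)
      then show ?thesis
        by (simp add: prod.distrib prod_dividef)
    qed
    also have "\<dots> = pmf (Pi_pmf ?S 0 (\<lambda>c. poisson_pmf (r * pmf p c))) k"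
      using True fin by (subst pmf_Pi') auto
    finally show ?thesis .
  qed
qed

lemma map_take_replicate_pmf:
  assumes "m \<le> n"
  shows "map_pmf (take m) (replicate_pmf n p) = replicate_pmf m p"
proof -
  have "replicate_pmf n p = replicate_pmf (m + (n - m)) p" using assms by simp
  also have "map_pmf (take m) \<dots> = bind_pmf (replicate_pmf m p) (\<lambda>xs. bind_pmf (replicate_pmf (n - m) p) (\<lambda>ys. return_pmf xs))"
    unfolding replicate_pmf_distrib map_bind_pmf map_return_pmf
    by (intro bind_pmf_cong refl) (auto simp: set_replicate_pmf)
  finally show ?thesis by (simp add: bind_return_pmf')
qed

section \<open>Coupling Poisson variables\<close>

lemma pmf_nat_eqI_tails:
  fixes P Q :: "nat pmf"
  assumes "\<And>k. measure P {k..} = measure Q {k..}"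
  shows "P = Q"
proof (rule pmf_eqI)
  fix k
  have "pmf R k = measure R {k..} - measure R {Suc k..}" for R :: "nat pmf"
  proof -
    have "measure R ({k..} - {Suc k..}) = measure R {k..} - measure R {Suc k..}"
      by (rule measure_pmf.finite_measure_Diff) auto
    moreover have "{k..} - {Suc k..} = {k}" by auto
    ultimately show ?thesis by (simp add: measure_pmf_single)
  qed
  then show "pmf P k = pmf Q k" using assms by simp
qed

text \<open>On a countable type the points of measure 0 form a null set. This makes a pmf out of the
  image of the uniform measure under a pair of quantile functions.\<close>

lemma pmf_of_countable_measure:
  fixes K :: "'a::countable measure"
  assumes "prob_space K" "sets K = UNIV"
  obtains J :: "'a pmf" where "measure_pmf J = K"
proof -
  interpret prob_space K by fact
  have "(\<Union>x\<in>{x. measure K {x} = 0}. {x}) \<in> null_sets K"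
    by (rule null_sets_UN') (auto simp: null_sets_def assms emeasure_eq_measure)
  then have "AE x in K. measure K {x} \<noteq> 0"
    by (rule AE_I') auto
  with assms have "K \<in> {M. prob_space M \<and> sets M = UNIV \<and> (AE x in M. measure M {x} \<noteq> 0)}"
    by blast
  then show ?thesis using that[of "Abs_pmf K"] Abs_pmf_inverse by blast
qed

text \<open>Descending quantiles: \<^term>\<open>quantile P u\<close> is large for small \<^term>\<open>u\<close>.\<close>

definition quantile :: "nat pmf \<Rightarrow> real \<Rightarrow> nat" where
  "quantile P u = (LEAST n. measure P {Suc n..} \<le> u)"

text \<open>The tails decrease to 0, so the least element defining \<open>quantile\<close> exists
  for positive \<open>u\<close>; the bound \<open>u < 1\<close> settles \<open>k = 0\<close>, whose
  tail has measure 1. For uniform \<open>u\<close> the equivalence gives \<open>quantile P u\<close>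
  exactly the tails of \<open>P\<close>.\<close>

lemma le_quantile_iff:
  assumes u: "0 < u" "u < 1"
  shows "k \<le> quantile P u \<longleftrightarrow> u < measure P {k..}"
proof -
  have "(\<lambda>n. measure P {n..}) \<longlonglongrightarrow> measure P (\<Inter>n. {n..})"
    by (rule measure_pmf.finite_Lim_measure_decseq) (auto simp: decseq_def)
  moreover have "(\<Inter>n::nat. {n..}) = {}"
    by (auto, metis Suc_n_not_le_n)
  ultimately have "(\<lambda>n. measure P {n..}) \<longlonglongrightarrow> 0" by simp
  from order_tendstoD(2)[OF LIMSEQ_Suc[OF this] u(1)] obtain n where "measure P {Suc n..} \<le> u"
    by (auto simp: eventually_sequentially intro: less_imp_le)
  then have Q: "measure P {Suc (quantile P u)..} \<le> u"
    unfolding quantile_def by (rule LeastI)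
  show ?thesis
  proof
    assume *: "k \<le> quantile P u"
    show "u < measure P {k..}"
    proof (cases k)
      case 0
      then show ?thesis using u by (simp add: atLeast_0)
    next
      case (Suc m)
      then have "\<not> measure P {Suc m..} \<le> u"
        using * unfolding quantile_def by (intro not_less_Least) auto
      then show ?thesis using Suc by simp
    qed
  next
    assume *: "u < measure P {k..}"
    show "k \<le> quantile P u"
    proof (rule ccontr)
      assume "\<not> k \<le> quantile P u"
      then have "measure P {k..} \<le> measure P {Suc (quantile P u)..}"
        by (intro measure_pmf.finite_measure_mono) auto
      with Q * show False by simp
    qed
  qed
qed

text \<open>Both variables are read off one uniform \<open>u\<close>. A failure
  \<open>n < h w\<close> puts \<open>u\<close> at or above the tail of \<open>P\<close> at
  \<open>h w\<close> and below the tail of \<open>Q\<close> at \<open>w\<close>. This contradicts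
  the first alternative of \<open>dom\<close>, and under the second it confines \<open>u\<close> to
  the interval from \<open>1 - \<epsilon>\<close> to 1. Values \<open>w\<close> above
  \<open>cap\<close> are given up at the price of a tail of \<open>Q\<close>.\<close>

lemma quantile_coupling:
  fixes P Q :: "nat pmf" and h :: "nat \<Rightarrow> nat"
  assumes eps: "0 \<le> \<epsilon>"
    and dom: "\<And>w. w \<le> cap \<Longrightarrow>
      measure Q {w..} \<le> measure P {h w..} \<or> 1 - \<epsilon> \<le> measure P {h w..}"
  obtains J where "map_pmf fst J = P" "map_pmf snd J = Q"
    "measure J {(n, w). n < h w} \<le> \<epsilon> + measure Q {Suc cap..}"
proof -
  define U :: "real measure" where "U = uniform_measure lborel {0<..<1}"
  have U: "prob_space U"
    unfolding U_def by (rule prob_space_uniform_measure) auto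
  interpret U: prob_space U by fact
  have sU[measurable_cong]: "sets U = sets borel" by (simp add: U_def)
  have [measurable]: "quantile R \<in> measurable U (count_space UNIV)" for R
    unfolding quantile_def[abs_def] by measurable
  have AEU: "AE u in U. 0 < u \<and> u < 1"
    unfolding U_def by (rule AE_uniform_measureI) auto
  have Ulen: "measure U {u. x \<le> u \<and> u < y} = y - x" if "0 \<le> x" "x \<le> y" "y \<le> 1" for x y
  proof -
    have "measure U {u. x \<le> u \<and> u < y} = measure lborel ({0<..<1} \<inter> {u. x \<le> u \<and> u < y})"
      unfolding U_def by (subst measure_uniform_measure) (auto simp: )
    also have "\<dots> = measure lborel ({0<..<1} \<inter> {x..<y})"
      by (rule arg_cong[where f = "measure lborel"]) auto
    also have "\<dots> = measure lborel {x..<y}"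
      using that by (intro measure_eq_AE) (auto intro!: AE_lborel_singleton[of 0, THEN eventually_mono])
    finally show ?thesis using that by simp
  qed
  define K where "K = distr U (count_space UNIV) (\<lambda>u. (quantile P u, quantile Q u))"
  have [measurable]: "(\<lambda>u. (quantile P u, quantile Q u)) \<in> measurable U (count_space UNIV)"
    by (rule measurable_compose_countable'[where f = "\<lambda>i u. (i, quantile Q u)" and g = "quantile P" and I = UNIV])
       (auto intro: measurable_compose_countable)
  have "prob_space K" unfolding K_def by (rule U.prob_space_distr) measurable
  then obtain J where J: "measure_pmf J = K"
    by (rule pmf_of_countable_measure) (simp add: K_def)
  have mJ: "measure J A = measure U {u. (quantile P u, quantile Q u) \<in> A}" for A
    unfolding J K_def by (subst measure_distr) (auto intro!: arg_cong[where f = "measure U"] simp: sets_eq_imp_space_eq[OF sU])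
  have tail: "measure U {u. k \<le> quantile R u} = measure R {k..}" for k R
  proof -
    have "measure U {u. k \<le> quantile R u} = measure U {u. 0 \<le> u \<and> u < measure R {k..}}"
    proof (rule measure_eq_AE)
      show "AE u in U. u \<in> {u. k \<le> quantile R u} \<longleftrightarrow> u \<in> {u. 0 \<le> u \<and> u < measure R {k..}}"
        using AEU by eventually_elim (auto simp: le_quantile_iff)
    qed auto
    then show ?thesis by (simp add: Ulen)
  qed
  have 1: "map_pmf fst J = P"
    by (rule pmf_nat_eqI_tails) (simp add: mJ tail vimage_def)
  have 2: "map_pmf snd J = Q"
    by (rule pmf_nat_eqI_tails) (simp add: mJ tail vimage_def)
  have "measure J {(n, w). n < h w} = measure U {u. quantile P u < h (quantile Q u)}"
    by (simp add: mJ)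
  also have "\<dots> \<le> measure U ({u. 1 - \<epsilon> \<le> u \<and> u < 1} \<union> {u. Suc cap \<le> quantile Q u})"
  proof (rule U.finite_measure_mono_AE)
    show "AE u in U. u \<in> {u. quantile P u < h (quantile Q u)} \<longrightarrow>
        u \<in> {u. 1 - \<epsilon> \<le> u \<and> u < 1} \<union> {u. Suc cap \<le> quantile Q u}"
      using AEU
    proof eventually_elim
      case (elim u)
      define w where "w = quantile Q u"
      show ?case
      proof (intro impI)
        assume "u \<in> {u. quantile P u < h (quantile Q u)}"
        then have "measure P {h w..} \<le> u"
          using le_quantile_iff[of u "h w" P] elim by (simp add: w_def not_le)
        moreover have "u < measure Q {w..}"
          using le_quantile_iff[of u w Q] elim by (simp add: w_def)
        ultimately show "u \<in> {u. 1 - \<epsilon> \<le> u \<and> u < 1} \<union> {u. Suc cap \<le> quantile Q u}"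
          using dom[of w] elim by (cases "w \<le> cap") (auto simp: w_def)
      qed
    qed
  qed auto
  also have "\<dots> \<le> measure U {u. 1 - \<epsilon> \<le> u \<and> u < 1} + measure U {u. Suc cap \<le> quantile Q u}"
    by (rule measure_Un_le) auto
  also have "measure U {u. 1 - \<epsilon> \<le> u \<and> u < 1} \<le> \<epsilon>"
  proof (cases "\<epsilon> \<le> 1")
    case True
    then show ?thesis using eps by (simp add: Ulen)
  next
    case False
    then show ?thesis using U.prob_le_1[of "{u. 1 - \<epsilon> \<le> u \<and> u < 1}"] by linarith
  qed
  finally have 3: "measure J {(n, w). n < h w} \<le> \<epsilon> + measure Q {Suc cap..}"
    by (simp add: tail)
  show ?thesis by (rule that[OF 1 2 3])
qed

section \<open>Tail bounds for Poisson variables\<close>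

text \<open>Since j! k! \<le> (j + k)!, the factor \<open>b ^ k / fact k\<close> comes out of the
  tail series, and what remains sums to \<open>exp b\<close>, which cancels
  \<open>exp (- b)\<close>.\<close>

lemma poisson_tail_le_power:
  assumes "b > 0"
  shows "measure (poisson_pmf b) {k..} \<le> b ^ k / fact k"
proof -
  have "(\<lambda>j. measure (poisson_pmf b) {j + k}) sums measure (poisson_pmf b) (\<Union>j. {j + k})"
    by (rule measure_pmf.finite_measure_UNION) (auto simp: disjoint_family_on_def)
  moreover have "(\<Union>j. {j + k}) = {k..}"
    by (auto simp: image_iff) (metis add.commute le_Suc_ex)
  ultimately have s1: "(\<lambda>j. b ^ (j + k) / fact (j + k) * exp (- b)) sums measure (poisson_pmf b) {k..}"
    using assms by (simp add: measure_pmf_single)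
  have "(\<lambda>j. b ^ j /\<^sub>R fact j * (b ^ k / fact k * exp (- b))) sums (exp b * (b ^ k / fact k * exp (- b)))"
    by (intro sums_mult2 exp_converges)
  then have s2: "(\<lambda>j. b ^ j /\<^sub>R fact j * (b ^ k / fact k * exp (- b))) sums (b ^ k / fact k)"
    by (simp add: mult_exp_exp mult.left_commute[of "exp b"])
  show ?thesis
  proof (rule sums_le[OF _ s1 s2])
    fix j
    have "fact j * fact k \<le> (fact (j + k) :: real)"
      using fact_fact_dvd_fact[of j k, where 'a = nat]
      by (metis dvd_imp_le fact_gt_zero of_nat_fact of_nat_le_iff of_nat_mult)
    then have "b ^ (j + k) / fact (j + k) \<le> b ^ (j + k) / (fact j * fact k)"
      using assms by (intro divide_left_mono) auto
    then have "b ^ (j + k) / fact (j + k) * exp (- b) \<le> b ^ (j + k) / (fact j * fact k) * exp (- b)"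
      by (rule mult_right_mono) simp
    also have "\<dots> = b ^ j /\<^sub>R fact j * (b ^ k / fact k * exp (- b))"
      by (simp add: power_add field_simps)
    finally show "b ^ (j + k) / fact (j + k) * exp (- b) \<le> b ^ j /\<^sub>R fact j * (b ^ k / fact k * exp (- b))" .
  qed
qed

lemma poisson_generating_function:
  assumes "r > 0" "x \<ge> 0"
  shows "(\<integral>\<^sup>+n. ennreal (x ^ n) \<partial>poisson_pmf r) = ennreal (exp (r * (x - 1)))"
proof -
  have s: "(\<lambda>n. (r * x) ^ n /\<^sub>R fact n * exp (- r)) sums (exp (r * x) * exp (- r))"
    by (intro sums_mult2 exp_converges)
  have "(\<integral>\<^sup>+n. ennreal (x ^ n) \<partial>poisson_pmf r) = (\<Sum>n. ennreal ((r * x) ^ n /\<^sub>R fact n * exp (- r)))"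
    unfolding nn_integral_measure_pmf nn_integral_count_space_nat
    using assms by (intro suminf_cong) (simp add: ennreal_mult'[symmetric] field_simps power_mult_distrib)
  also have "\<dots> = ennreal (exp (r * x) * exp (- r))"
    using s assms by (subst suminf_ennreal2) (auto simp: sums_iff)
  finally show ?thesis by (simp add: mult_exp_exp algebra_simps)
qed

text \<open>Markov's inequality for x^N. The condition on \<open>A\<close> covers both tails: upper
  sets with \<open>x > 1\<close> and lower sets with \<open>x < 1\<close>; the values 2 and 1/2 are
  used below.\<close>

lemma poisson_chernoff:
  assumes r: "r > 0" and x: "x > 0"
    and A: "\<And>n. n \<in> A \<Longrightarrow> x powr y \<le> x ^ n"
  shows "measure (poisson_pmf r) A \<le> exp (r * (x - 1)) / x powr y"
proof -
  have "emeasure (poisson_pmf r) A = (\<integral>\<^sup>+n. indicator A n \<partial>poisson_pmf r)"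
    by simp
  also have "\<dots> \<le> (\<integral>\<^sup>+n. ennreal (1 / x powr y) * ennreal (x ^ n) \<partial>poisson_pmf r)"
    using A x by (intro nn_integral_mono) (auto simp: indicator_def ennreal_mult'[symmetric])
  also have "\<dots> = ennreal (exp (r * (x - 1)) / x powr y)"
    using r x by (subst nn_integral_cmult) (auto simp: poisson_generating_function ennreal_mult'[symmetric])
  finally show ?thesis by (simp add: measure_pmf.emeasure_eq_measure)
qed

lemma poisson_upper_tail:
  assumes "r > 0"
  shows "measure (poisson_pmf r) {n. y \<le> real n} \<le> exp (r - ln 2 * y)"
  using poisson_chernoff[OF assms, of 2 "{n. y \<le> real n}" y]
  by (auto simp: powr_realpow[symmetric] powr_def exp_diff mult.commute)

lemma poisson_lower_tail:
  assumes "r > 0"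
  shows "measure (poisson_pmf r) {n. real n \<le> y} \<le> exp (ln 2 * y - r / 2)"
proof -
  have "measure (poisson_pmf r) {n. real n \<le> y} \<le> exp (r * (1 / 2 - 1)) / (1 / 2) powr y"
  proof (rule poisson_chernoff[OF assms])
    fix n assume "n \<in> {n. real n \<le> y}"
    then show "(1 / 2 :: real) powr y \<le> (1 / 2) ^ n"
      by (simp add: powr_mono' flip: powr_realpow)
  qed simp
  also have "\<dots> = exp (ln 2 * y - r / 2)"
    by (simp add: powr_def ln_div exp_diff[symmetric])
  finally show ?thesis .
qed

text \<open>With \<open>k = w\<close> this exchanges w! for (2 w)! at the price of (2 w)^w, so that
  the tail of the second variable at \<open>w\<close> becomes comparable with the weight of the
  first one at \<open>2 * w\<close>.\<close>

lemma fact_add_le_power_mult: "fact (w + k) \<le> real (w + k) ^ k * fact w"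
proof (induction k)
  case (Suc k)
  have "fact (w + Suc k) = real (w + Suc k) * fact (w + k)"
    by simp
  also have "\<dots> \<le> real (w + Suc k) * (real (w + k) ^ k * fact w)"
    by (rule mult_left_mono[OF Suc]) simp
  also have "\<dots> \<le> real (w + Suc k) * (real (w + Suc k) ^ k * fact w)"
    by (intro mult_left_mono mult_right_mono power_mono) auto
  finally show ?case by simp
qed simp

text \<open>For small \<^term>\<open>a\<close> the tails are compared up to \<^term>\<open>\<kappa>\<close>: beyond \<^term>\<open>a / 8\<close> through the
  bounds \<^term>\<open>b ^ w / fact w\<close> and \<^term>\<open>a ^ (2 * w) / fact (2 * w) * exp (- a)\<close>, and below because half of
  the first variable rarely drops under \<^term>\<open>a / 8\<close>. For large \<^term>\<open>a\<close> both variables are concentrated.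
  The error bound carries the factor \<^term>\<open>a\<close> because it will be summed over arbitrarily many colours.\<close>

lemma poisson_half_coupling:
  fixes \<kappa> a b :: real
  assumes kappa: "\<kappa> \<ge> 100" and a: "a > 0" and b: "b > 0"
    and ba: "b \<le> a / (4 * \<kappa>)" and ba2: "b \<le> a\<^sup>2 / (20 * \<kappa> ^ 3)"
  obtains J where "map_pmf fst J = poisson_pmf a" "map_pmf snd J = poisson_pmf b"
    "measure J {(n, w). n < 2 * w} \<le> 2 * a * exp (- \<kappa> / 8)"
proof -
  have ba': "b \<le> a / 400"
  proof (rule order_trans[OF ba])
    show "a / (4 * \<kappa>) \<le> a / 400"
      using kappa a by (intro divide_left_mono) auto
  qed
  \<comment> \<open>For such \<open>w\<close> a value below \<open>2 * w\<close> is below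
    \<open>a / 4\<close>, half of what the lower Chernoff bound can bear: the exponent (ln 2 - 2) a
    / 4 is at most - a / 4.\<close>
  have low: "1 - exp (- a / 4) \<le> measure (poisson_pmf a) {2 * w..}" if "real w \<le> a / 8" for w
  proof -
    have "measure (poisson_pmf a) (UNIV - {2 * w..}) \<le> measure (poisson_pmf a) {n. real n \<le> a / 4}"
      by (rule measure_pmf.finite_measure_mono) (use that in auto)
    also have "\<dots> \<le> exp (ln 2 * (a / 4) - a / 2)"
      by (rule poisson_lower_tail[OF a])
    also have "\<dots> \<le> exp (- a / 4)"
      using mult_right_mono[of "ln 2" 1 "a / 4"] ln_2_less_1 a by (simp only: exp_le_cancel_iff) linarith
    finally show ?thesis
      using measure_pmf.prob_compl[of "{2 * w..}" "poisson_pmf a"] by simp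
  qed
  show ?thesis
  \<comment> \<open>The threshold serves both cases: below it \<open>b \<le> 1 / 2\<close> follows
    from \<open>ba\<close>, and above it \<open>exp (- a / 16)\<close> is at most
    \<open>exp (- \<kappa> / 8)\<close>, while \<open>a > 1\<close> supplies the factor
    \<open>a\<close> for free.\<close>
  proof (cases "a \<le> 2 * \<kappa>")
    case True
    have b2: "b \<le> 1 / 2"
    proof -
      have "a / (4 * \<kappa>) \<le> 2 * \<kappa> / (4 * \<kappa>)"
        using True kappa by (intro divide_right_mono) auto
      moreover have "2 * \<kappa> / (4 * \<kappa>) = 1 / 2"
        using kappa by simp
      ultimately show ?thesis using ba by linarith
    qed
    \<comment> \<open>No slack is granted here, since a constant error would not be proportional to
      \<open>a\<close>. The only loss is the tail of the second variable beyond \<kappa>.\<close>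
    obtain J where J: "map_pmf fst J = poisson_pmf a" "map_pmf snd J = poisson_pmf b"
      "measure J {(n, w). n < 2 * w} \<le> 0 + measure (poisson_pmf b) {Suc (nat \<lfloor>\<kappa>\<rfloor>)..}"
    proof (rule quantile_coupling[of 0 "nat \<lfloor>\<kappa>\<rfloor>" "poisson_pmf b" "poisson_pmf a" "\<lambda>w. 2 * w"])
      fix w assume "w \<le> nat \<lfloor>\<kappa>\<rfloor>"
      then have w: "real w \<le> \<kappa>" using kappa by linarith
      consider "w = 0" | "w > 0" "real w \<le> a / 8" | "w > 0" "a / 8 < real w" by linarith
      then have "measure (poisson_pmf b) {w..} \<le> measure (poisson_pmf a) {2 * w..}"
      proof cases
        case 1
        then show ?thesis by (simp add: atLeast_0)
      next
        case 2
        have "measure (poisson_pmf b) {w..} \<le> measure (poisson_pmf b) {1..}"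
          by (rule measure_pmf.finite_measure_mono) (use 2 in auto)
        also have "\<dots> \<le> 1 / 2"
          using poisson_tail_le_power[OF b, of 1] b2 by simp
        also have "1 / 2 \<le> 1 - exp (- a / 4)"
        proof -
          have "exp (- a / 4) \<le> exp (- 1)" using 2 by simp
          also have "\<dots> \<le> (1 / 2 :: real)"
            using exp_ge_add_one_self[of 1] by (simp add: exp_minus field_simps)
          finally show ?thesis by simp
        qed
        also have "\<dots> \<le> measure (poisson_pmf a) {2 * w..}" using low 2 by simp
        finally show ?thesis .
      next
        case 3
        have "2 * real w * b \<le> 2 * \<kappa> * (a\<^sup>2 / (20 * \<kappa> ^ 3))"
          using w ba2 b kappa by (intro mult_mono) auto
        also have "\<dots> = a\<^sup>2 / (10 * \<kappa>\<^sup>2)"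
          using kappa by (simp add: field_simps power2_eq_square power3_eq_cube)
        \<comment> \<open>The constant 8 matches the split at \<open>a / 8\<close>: the w-th power
          leaves a factor \<open>exp (- 8 * real w)\<close>, which for \<open>a / 8 < real w\<close>
          is at most the factor \<open>exp (- a)\<close> of the Poisson weight.\<close>
        also have "\<dots> \<le> a\<^sup>2 / exp 8"
        proof (rule divide_left_mono)
          have "exp 8 = (exp 1 :: real) ^ 8" by (simp flip: exp_of_nat_mult)
          also have "\<dots> \<le> 3 ^ 8" by (rule power_mono) (use exp_le in auto)
          also have "\<dots> \<le> 10 * 100\<^sup>2" by simp
          also have "\<dots> \<le> 10 * \<kappa>\<^sup>2" using kappa by (intro mult_left_mono power_mono) auto
          finally show "exp 8 \<le> 10 * \<kappa>\<^sup>2" .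
        qed (use kappa in auto)
        finally have key: "2 * real w * b \<le> a\<^sup>2 / exp 8" .
        have "measure (poisson_pmf b) {w..} \<le> b ^ w / fact w"
          by (rule poisson_tail_le_power[OF b])
        also have "\<dots> \<le> b ^ w * (real (w + w) ^ w / fact (w + w))"
        proof -
          have "1 / fact w \<le> real (w + w) ^ w / fact (w + w)"
            using fact_add_le_power_mult[of w w] by (simp add: field_simps)
          from mult_left_mono[OF this, of "b ^ w"] b show ?thesis by simp
        qed
        also have "\<dots> = (2 * real w * b) ^ w / fact (2 * w)"
        proof -
          have "w + w = 2 * w" "real (2 * w) = 2 * real w" by simp_all
          then show ?thesis by (simp only: power_mult_distrib times_divide_eq_right mult.commute)
        qed
        also have "\<dots> \<le> (a\<^sup>2 / exp 8) ^ w / fact (2 * w)"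
          using key b by (intro divide_right_mono power_mono) auto
        also have "\<dots> = a ^ (2 * w) / fact (2 * w) * exp (- 8 * real w)"
        proof -
          have "exp 8 ^ w = exp (8 * real w)" by (rule exp_of_nat2_mult[symmetric])
          then show ?thesis by (simp add: power_divide power_mult exp_minus divide_inverse power_mult_distrib power_inverse)
        qed
        also have "\<dots> \<le> a ^ (2 * w) / fact (2 * w) * exp (- a)"
          using 3 a by (intro mult_left_mono) auto
        also have "\<dots> = measure (poisson_pmf a) {2 * w}"
          using a by (simp add: measure_pmf_single)
        also have "\<dots> \<le> measure (poisson_pmf a) {2 * w..}"
          by (rule measure_pmf.finite_measure_mono) auto
        finally show ?thesis .
      qed
      then show "measure (poisson_pmf b) {w..} \<le> measure (poisson_pmf a) {2 * w..} \<or>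
          1 - 0 \<le> measure (poisson_pmf a) {2 * w..}" ..
    qed auto
    have "measure (poisson_pmf b) {Suc (nat \<lfloor>\<kappa>\<rfloor>)..} \<le> b ^ Suc (nat \<lfloor>\<kappa>\<rfloor>) / fact (Suc (nat \<lfloor>\<kappa>\<rfloor>))"
      by (rule poisson_tail_le_power[OF b])
    also have "\<dots> \<le> b ^ Suc (nat \<lfloor>\<kappa>\<rfloor>) / 1"
      using b fact_ge_1[of "Suc (nat \<lfloor>\<kappa>\<rfloor>)", where 'a = real] by (intro divide_left_mono) auto
    \<comment> \<open>One factor \<open>b\<close> is kept because it is bounded by \<open>a\<close>
      and so yields the required proportionality; each of the others is at most 1/2, hence at most
      \<open>exp (- 1 / 2)\<close>.\<close>
    also have "\<dots> \<le> b * exp (- 1 / 2) ^ nat \<lfloor>\<kappa>\<rfloor>"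
      using b2 b exp_ge_add_one_self[of "- 1 / 2"] by (simp add: power_mono)
    also have "\<dots> \<le> a * exp (- \<kappa> / 8)"
    proof (rule mult_mono)
      have "exp (- 1 / 2 :: real) ^ nat \<lfloor>\<kappa>\<rfloor> = exp (- real (nat \<lfloor>\<kappa>\<rfloor>) / 2)"
        by (simp flip: exp_of_nat_mult)
      moreover have "- real (nat \<lfloor>\<kappa>\<rfloor>) / 2 \<le> - \<kappa> / 8"
        using kappa by linarith
      ultimately show "exp (- 1 / 2 :: real) ^ nat \<lfloor>\<kappa>\<rfloor> \<le> exp (- \<kappa> / 8)" by simp
    qed (use ba' a in auto)
    also have "\<dots> \<le> 2 * a * exp (- \<kappa> / 8)" using a by simp
    finally show ?thesis using J that by force
  next
    case False
    obtain J where J: "map_pmf fst J = poisson_pmf a" "map_pmf snd J = poisson_pmf b"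
      "measure J {(n, w). n < 2 * w} \<le> exp (- a / 4) + measure (poisson_pmf b) {Suc (nat \<lfloor>a / 8\<rfloor>)..}"
    proof (rule quantile_coupling[of "exp (- a / 4)" "nat \<lfloor>a / 8\<rfloor>" "poisson_pmf b" "poisson_pmf a" "\<lambda>w. 2 * w"])
      fix w assume "w \<le> nat \<lfloor>a / 8\<rfloor>"
      then have "real w \<le> a / 8" using a by linarith
      from low[OF this] show "measure (poisson_pmf b) {w..} \<le> measure (poisson_pmf a) {2 * w..} \<or>
          1 - exp (- a / 4) \<le> measure (poisson_pmf a) {2 * w..}" ..
    qed auto
    have "measure (poisson_pmf b) {Suc (nat \<lfloor>a / 8\<rfloor>)..} \<le> measure (poisson_pmf b) {n. a / 8 \<le> real n}"
      by (rule measure_pmf.finite_measure_mono) (auto, linarith)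
    also have "\<dots> \<le> exp (b - ln 2 * (a / 8))"
      by (rule poisson_upper_tail[OF b])
    also have "\<dots> \<le> exp (- a / 16)"
      using mult_right_mono[OF ln2_ge_two_thirds, of "a / 8"] ba' a by (simp only: exp_le_cancel_iff) linarith
    also have "\<dots> \<le> exp (- \<kappa> / 8)" using False by simp
    finally have "measure (poisson_pmf b) {Suc (nat \<lfloor>a / 8\<rfloor>)..} \<le> exp (- \<kappa> / 8)" .
    moreover have "exp (- a / 4) \<le> exp (- \<kappa> / 8)" using False a by simp
    moreover have "exp (- \<kappa> / 8) \<le> a * exp (- \<kappa> / 8)"
      using False kappa by simp
    ultimately have "measure J {(n, w). n < 2 * w} \<le> 2 * a * exp (- \<kappa> / 8)"
      using J(3) by linarith
    with J show ?thesis by (intro that[of J])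
  qed
qed

section \<open>Pairs dominate collisions\<close>

text \<open>A value of \<open>f\<close> drawn first and a point drawn conditionally on it have the
  joint law of \<open>f x\<close> and \<open>x\<close>. This rebuilds a list from its counts, and a
  lattice point from its coset.\<close>

lemma bind_map_cond_pmf:
  "bind_pmf (map_pmf f P) (\<lambda>y. bind_pmf (cond_pmf P {x. f x = y}) (h y)) = bind_pmf P (\<lambda>x. h (f x) x)"
proof -
  have ne: "set_pmf P \<inter> {x. f x = y} \<noteq> {}" if "y \<in> set_pmf (map_pmf f P)" for y
    using that by auto
  have "bind_pmf (map_pmf f P) (\<lambda>y. bind_pmf (cond_pmf P {x. f x = y}) (h y)) =
      bind_pmf (map_pmf f P) (\<lambda>y. bind_pmf (cond_pmf P {x. f x = y}) (\<lambda>x. h (f x) x))"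
    using ne by (intro bind_pmf_cong refl) auto
  also have "\<dots> = bind_pmf (bind_pmf (map_pmf f P) (\<lambda>y. cond_pmf P {x. f x = y})) (\<lambda>x. h (f x) x)"
    by (simp add: bind_assoc_pmf)
  also have "bind_pmf (map_pmf f P) (\<lambda>y. cond_pmf P {x. f x = y}) = P"
  proof (rule bind_cond_pmf_cancel[where R = "\<lambda>y x. f x = y"])
    fix y x assume "f x = y"
    then show "measure P {x. f x = y} = measure (map_pmf f P) {y. f x = y}"
      by (auto intro!: arg_cong[where f = "measure P"])
  qed (use ne in auto)
  finally show ?thesis .
qed

lemma map_length_poisson_sample: "map_pmf length (poisson_sample r p) = poisson_pmf r"
proof -
  have "map_pmf length (poisson_sample r p) = bind_pmf (poisson_pmf r) (\<lambda>n. bind_pmf (replicate_pmf n p) (\<lambda>_. return_pmf n))"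
    unfolding poisson_sample_def map_bind_pmf map_pmf_def bind_assoc_pmf bind_return_pmf
    by (intro bind_pmf_cong refl) (auto simp: set_replicate_pmf)
  then show ?thesis by (simp add: bind_return_pmf')
qed

lemma count_list_take_le: "count_list (take n xs) c \<le> count_list xs c"
proof -
  have "count_list (take n xs @ drop n xs) c = count_list (take n xs) c + count_list (drop n xs) c"
    by (rule count_list_append)
  then show ?thesis by simp
qed

lemma set_poisson_sample_subset: "xs \<in> set_pmf (poisson_sample r p) \<Longrightarrow> set xs \<subseteq> set_pmf p"
  by (auto simp: poisson_sample_def set_replicate_pmf)

lemma measure_poisson_sample_counts:
  assumes fin: "finite (set_pmf p)"
  shows "measure (map_pmf count_list (poisson_sample r p)) {m. Q (\<Sum>c\<in>set_pmf p. m c)} = measure (poisson_pmf r) {n. Q n}"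
proof -
  have "measure (map_pmf count_list (poisson_sample r p)) {m. Q (\<Sum>c\<in>set_pmf p. m c)} =
      measure (poisson_sample r p) {xs. Q (\<Sum>c\<in>set_pmf p. count_list xs c)}"
    by (simp add: vimage_def)
  also have "\<dots> = measure (poisson_sample r p) {xs. Q (length xs)}"
    by (rule measure_pmf.finite_measure_eq_AE)
       (auto simp: AE_measure_pmf_iff sum_count_list_eq_length[OF fin set_poisson_sample_subset])
  also have "\<dots> = measure (map_pmf length (poisson_sample r p)) {n. Q n}"
    by (simp add: vimage_def)
  finally show ?thesis by (simp add: map_length_poisson_sample)
qed

text \<open>In the pair of lists drawn from \<^term>\<open>J\<close>, the second one is an honest sample from \<^term>\<open>w\<close>. The
  first one is the same list, emptied on the rare event that the coupled Poisson counts do not contain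
  it; hence it is close to the second one and dominated by the pairs at the same time.\<close>

theorem pairs_dominate_collision_samples:
  fixes p w :: "'c pmf" and M M' :: nat and \<kappa> pmax pcol :: real
  assumes fin: "finite (set_pmf p)"
    and kappa: "\<kappa> \<ge> 100" "\<kappa> \<ge> 16 * ln (real M)"
    and pmax: "\<And>c. pmf p c \<le> pmax" "pmf p c0 = pmax"
    and M: "real M \<ge> 10 * \<kappa>\<^sup>2 / pmax"
    and pcol: "pcol = (\<Sum>c\<in>set_pmf p. (pmf p c)\<^sup>2)"
    and w: "\<And>c. pmf w c = (pmf p c)\<^sup>2 / pcol"
    and M': "M' = nat \<lceil>real M / (32 * \<kappa>) * (pcol / pmax)\<rceil>"
  obtains J :: "('c list \<times> 'c list) pmf" where
    "map_pmf snd J = replicate_pmf M' w"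
    "\<And>V W. (V, W) \<in> set_pmf J \<Longrightarrow> set V \<subseteq> set W"
    "measure J {(V, W). V \<noteq> W} \<le> exp (- \<kappa> / 32)"
    "\<And>F G :: 'c list \<Rightarrow> ennreal.
       (\<And>V es. (\<forall>c. count_list V c \<le> count_list es c div 2) \<Longrightarrow> F V \<le> G es) \<Longrightarrow>
       (\<integral>\<^sup>+x. F (fst x) \<partial>J) \<le> (\<integral>\<^sup>+es. G es \<partial>replicate_pmf M p)"
proof -
  let ?S = "set_pmf p"
  have pmax0: "pmax > 0"
  proof -
    obtain c where "c \<in> ?S" using set_pmf_not_empty by fast
    then have "0 < pmf p c" by (rule pmf_positive)
    with pmax(1)[of c] show ?thesis by linarith
  qed
  then have c0: "c0 \<in> ?S" using pmax(2) by (simp add: set_pmf_iff)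
  have pcol_ge: "pmax\<^sup>2 \<le> pcol"
    unfolding pcol pmax(2)[symmetric] by (rule member_le_sum) (use c0 fin in auto)
  have pcol0: "pcol > 0" using pcol_ge pmax0 by (smt (verit) zero_less_power)
  have setw: "set_pmf w = ?S"
    using pcol0 by (auto simp: set_pmf_iff w)
  define x where "x = real M / (32 * \<kappa>) * (pcol / pmax)"
  have Mp: "10 * \<kappa>\<^sup>2 \<le> real M * pmax"
    using M pmax0 by (simp add: field_simps)
  \<comment> \<open>This exceeds 1, so the ceiling in \<open>M'\<close> at most doubles
    \<open>x\<close>. Being linear in \<kappa>, it also makes it exponentially unlikely that a
    Poisson variable of mean \<open>2 * M'\<close> stays below \<open>M'\<close>.\<close>
  have x_ge: "10 * \<kappa> / 32 \<le> x"
  proof -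
    have "10 * \<kappa> / 32 = 10 * \<kappa>\<^sup>2 / (32 * \<kappa>)"
      using kappa by (simp add: power2_eq_square)
    also have "\<dots> \<le> real M * pmax / (32 * \<kappa>)"
      using Mp kappa by (intro divide_right_mono) auto
    also have "\<dots> = real M / (32 * \<kappa>) * (pmax\<^sup>2 / pmax)"
      using pmax0 by (simp add: power2_eq_square)
    also have "\<dots> \<le> x"
      unfolding x_def using pcol_ge pmax0 kappa by (intro mult_left_mono divide_right_mono) auto
    finally show ?thesis .
  qed
  have M'x: "x \<le> real M'" "real M' \<le> 2 * x"
    using x_ge kappa unfolding M' x_def[symmetric] by linarith+
  have M_ge: "\<kappa> \<le> real M"
  proof -
    have "\<kappa> * 1 \<le> \<kappa> * (10 * \<kappa>)" using kappa by (intro mult_left_mono) auto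
    also have "\<dots> \<le> real M * pmax" using Mp by (simp add: power2_eq_square)
    also have "\<dots> \<le> real M * 1" using pmax(2) by (intro mult_left_mono) (auto simp: pmf_le_1)
    finally show ?thesis by simp
  qed
  define r where "r = real M / 2"
  define q where "q = 2 * real M'"
  have r0: "r > 0" using M_ge kappa by (simp add: r_def)
  have q0: "q > 0" using M'x x_ge kappa by (simp add: q_def)
  have "\<exists>J. map_pmf fst J = poisson_pmf (r * pmf p c) \<and> map_pmf snd J = poisson_pmf (q * pmf w c) \<and>
      measure J {(n, w). n < 2 * w} \<le> 2 * (r * pmf p c) * exp (- \<kappa> / 8)" if c: "c \<in> ?S" for c
  proof -
    have pc: "0 < pmf p c" using c by (rule pmf_positive)
    \<comment> \<open>Both hypotheses of the half coupling come from this bound: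
      \<open>pmf p c \<le> pmax\<close> gives the one linear in \<open>r * pmf p c\<close>, and
      \<open>1 / pmax \<le> real M / (10 * \<kappa>\<^sup>2)\<close> gives the quadratic
      one.\<close>
    have b: "q * pmf w c \<le> real M * (pmf p c)\<^sup>2 / (8 * \<kappa> * pmax)"
    proof -
      have "q * pmf w c \<le> 4 * x * ((pmf p c)\<^sup>2 / pcol)"
        unfolding q_def w using M'x pcol0 by (intro mult_right_mono) auto
      also have "\<dots> = real M * (pmf p c)\<^sup>2 / (8 * \<kappa> * pmax)"
        using pcol0 pmax0 kappa unfolding x_def by (simp add: field_simps)
      finally show ?thesis .
    qed
    also have "\<dots> = (r * pmf p c) / (4 * \<kappa>) * (pmf p c / pmax)"
      by (simp add: r_def power2_eq_square)
    also have "\<dots> \<le> (r * pmf p c) / (4 * \<kappa>) * 1"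
      using pmax(1)[of c] pmax0 kappa r0 pc by (intro mult_left_mono) auto
    finally have b1: "q * pmf w c \<le> (r * pmf p c) / (4 * \<kappa>)" by simp
    have "real M * (pmf p c)\<^sup>2 / (8 * \<kappa> * pmax) = real M * (pmf p c)\<^sup>2 / (8 * \<kappa>) * (1 / pmax)"
      by simp
    also have "\<dots> \<le> real M * (pmf p c)\<^sup>2 / (8 * \<kappa>) * (real M / (10 * \<kappa>\<^sup>2))"
      using Mp kappa pmax0 by (intro mult_left_mono) (auto simp: field_simps)
    also have "\<dots> = (r * pmf p c)\<^sup>2 / (20 * \<kappa> ^ 3)"
      by (simp add: r_def power2_eq_square power3_eq_cube mult_ac)
    finally have b2: "q * pmf w c \<le> (r * pmf p c)\<^sup>2 / (20 * \<kappa> ^ 3)"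
      using b by linarith
    have "0 < r * pmf p c" "0 < q * pmf w c"
      using r0 q0 pc pcol0 by (auto simp: w)
    from poisson_half_coupling[OF kappa(1) this b1 b2] show ?thesis by blast
  qed
  then obtain Jc where Jc: "\<And>c. c \<in> ?S \<Longrightarrow> map_pmf fst (Jc c) = poisson_pmf (r * pmf p c)"
      "\<And>c. c \<in> ?S \<Longrightarrow> map_pmf snd (Jc c) = poisson_pmf (q * pmf w c)"
      "\<And>c. c \<in> ?S \<Longrightarrow> measure (Jc c) {(n, w). n < 2 * w} \<le> 2 * (r * pmf p c) * exp (- \<kappa> / 8)"
    by metis
  \<comment> \<open>The couplings are independent over the colours; the default value agrees with
    \<open>count_list\<close>, which vanishes off the support.\<close>
  define D where "D = Pi_pmf ?S (0, 0) Jc"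
  define \<Lambda> where "\<Lambda> = poisson_sample q w"
  have fstD: "map_pmf (\<lambda>f. fst \<circ> f) D = map_pmf count_list (poisson_sample r p)"
    unfolding D_def poisson_sample_counts[OF fin r0] using fin
    by (subst Pi_pmf_map[symmetric, where dflt' = 0]) (auto intro!: Pi_pmf_cong Jc)
  have sndD: "map_pmf (\<lambda>f. snd \<circ> f) D = map_pmf count_list \<Lambda>"
    unfolding D_def \<Lambda>_def poisson_sample_counts[OF fin[folded setw] q0] using fin
    by (subst Pi_pmf_map[symmetric, where dflt' = 0]) (auto intro!: Pi_pmf_cong Jc simp: setw)
  \<comment> \<open>The target list is drawn given its counts and cut to length \<open>M'\<close>. A
    Poisson list that is too short is replaced by a fresh sample, so the second component of
    \<open>J\<close> has exactly the law \<open>replicate_pmf M' w\<close>, with no conditioning on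
    success.\<close>
  define H where "H m = (if M' \<le> (\<Sum>c\<in>?S. m c)
      then map_pmf (take M') (cond_pmf \<Lambda> {xs. count_list xs = m}) else replicate_pmf M' w)" for m
  define ok where "ok f \<longleftrightarrow> (\<Sum>c\<in>?S. fst (f c)) \<le> M \<and> (\<forall>c\<in>?S. 2 * snd (f c) \<le> fst (f c)) \<and>
      M' \<le> (\<Sum>c\<in>?S. snd (f c))" for f :: "'c \<Rightarrow> nat \<times> nat"
  define J where "J = bind_pmf D (\<lambda>f. map_pmf (\<lambda>W. (if ok f then W else [], W)) (H (snd \<circ> f)))"
  have J1: "map_pmf snd J = replicate_pmf M' w"
  proof -
    have "map_pmf snd J = bind_pmf (map_pmf (\<lambda>f. snd \<circ> f) D) H"
      unfolding J_def by (simp add: map_bind_pmf pmf.map_comp o_def bind_map_pmf)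
    also have "\<dots> = bind_pmf (map_pmf count_list \<Lambda>) (\<lambda>m. bind_pmf (cond_pmf \<Lambda> {xs. count_list xs = m})
        (\<lambda>xs. if M' \<le> (\<Sum>c\<in>?S. m c) then return_pmf (take M' xs) else replicate_pmf M' w))"
      unfolding sndD by (intro bind_pmf_cong refl) (auto simp: H_def map_pmf_def)
    also have "\<dots> = bind_pmf \<Lambda> (\<lambda>xs. if M' \<le> (\<Sum>c\<in>?S. count_list xs c) then return_pmf (take M' xs) else replicate_pmf M' w)"
      by (rule bind_map_cond_pmf)
    also have "\<dots> = bind_pmf \<Lambda> (\<lambda>xs. if M' \<le> length xs then return_pmf (take M' xs) else replicate_pmf M' w)"
      by (intro bind_pmf_cong refl if_cong)
         (auto simp: \<Lambda>_def sum_count_list_eq_length[OF fin] dest!: set_poisson_sample_subset[unfolded setw] simp: setw)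
    also have "\<dots> = bind_pmf (poisson_pmf q) (\<lambda>n. bind_pmf (replicate_pmf n w)
        (\<lambda>xs. if M' \<le> n then return_pmf (take M' xs) else replicate_pmf M' w))"
      unfolding \<Lambda>_def poisson_sample_def bind_assoc_pmf
      by (intro bind_pmf_cong refl) (auto simp: set_replicate_pmf)
    also have "\<dots> = bind_pmf (poisson_pmf q) (\<lambda>n. replicate_pmf M' w)"
    proof (intro bind_pmf_cong refl)
      fix n
      show "bind_pmf (replicate_pmf n w) (\<lambda>xs. if M' \<le> n then return_pmf (take M' xs) else replicate_pmf M' w) =
          replicate_pmf M' w"
        using map_take_replicate_pmf[of M' n w] by (cases "M' \<le> n") (simp_all add: map_pmf_def)
    qed
    finally show ?thesis by simp
  qed
  have J0: "set V \<subseteq> set W" if "(V, W) \<in> set_pmf J" for V W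
    using that by (auto simp: J_def split: if_splits)
  have J2: "measure J {(V, W). V \<noteq> W} \<le> exp (- \<kappa> / 32)"
  proof -
    have "emeasure J {(V, W). V \<noteq> W} = (\<integral>\<^sup>+x. indicator {(V, W). V \<noteq> W} x \<partial>J)"
      by simp
    also have "\<dots> = (\<integral>\<^sup>+f. \<integral>\<^sup>+W. indicator {(V, W). V \<noteq> W} (if ok f then W else [], W) \<partial>H (snd \<circ> f) \<partial>D)"
      unfolding J_def by simp
    also have "\<dots> \<le> (\<integral>\<^sup>+f. \<integral>\<^sup>+W. indicator {f. \<not> ok f} f \<partial>H (snd \<circ> f) \<partial>D)"
      by (intro nn_integral_mono) (auto simp: indicator_def)
    also have "\<dots> = emeasure D {f. \<not> ok f}" by simp
    finally have "measure J {(V, W). V \<noteq> W} \<le> measure D {f. \<not> ok f}"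
      by (simp add: measure_pmf.emeasure_eq_measure)
    also have "\<dots> \<le> measure D ({f. M < (\<Sum>c\<in>?S. fst (f c))} \<union> (\<Union>c\<in>?S. {f. fst (f c) < 2 * snd (f c)}) \<union>
        {f. (\<Sum>c\<in>?S. snd (f c)) < M'})"
      by (rule measure_pmf.finite_measure_mono) (auto simp: ok_def not_le)
    also have "\<dots> \<le> measure D {f. M < (\<Sum>c\<in>?S. fst (f c))} + measure D (\<Union>c\<in>?S. {f. fst (f c) < 2 * snd (f c)}) +
        measure D {f. (\<Sum>c\<in>?S. snd (f c)) < M'}"
      by (intro order_trans[OF measure_Un_le] add_right_mono measure_Un_le) auto
    also have "measure D {f. M < (\<Sum>c\<in>?S. fst (f c))} \<le> exp (- \<kappa> / 16)"
    proof -
      have "measure D {f. M < (\<Sum>c\<in>?S. fst (f c))} = measure (map_pmf (\<lambda>f. fst \<circ> f) D) {m. M < (\<Sum>c\<in>?S. m c)}"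
        by (simp add: vimage_def)
      also have "\<dots> = measure (poisson_pmf r) {n. M < n}"
        unfolding fstD by (rule measure_poisson_sample_counts[OF fin])
      also have "\<dots> \<le> measure (poisson_pmf r) {n. real M \<le> real n}"
        by (rule measure_pmf.finite_measure_mono) auto
      also have "\<dots> \<le> exp (r - ln 2 * real M)"
        by (rule poisson_upper_tail[OF r0])
      also have "\<dots> \<le> exp (- \<kappa> / 16)"
        using mult_right_mono[OF ln2_ge_two_thirds, of "real M"] M_ge kappa
        by (simp only: exp_le_cancel_iff r_def) linarith
      finally show ?thesis .
    qed
    also have "measure D (\<Union>c\<in>?S. {f. fst (f c) < 2 * snd (f c)}) \<le> exp (- \<kappa> / 16)"
    proof -
      have "measure D (\<Union>c\<in>?S. {f. fst (f c) < 2 * snd (f c)}) \<le> (\<Sum>c\<in>?S. measure D {f. fst (f c) < 2 * snd (f c)})"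
        by (rule measure_UNION_le) (use fin in auto)
      also have "\<dots> \<le> (\<Sum>c\<in>?S. 2 * (r * pmf p c) * exp (- \<kappa> / 8))"
      proof (rule sum_mono)
        fix c assume c: "c \<in> ?S"
        have "measure D {f. fst (f c) < 2 * snd (f c)} = measure (map_pmf (\<lambda>f. f c) D) {(n, w). n < 2 * w}"
          by (simp add: vimage_def case_prod_beta)
        also have "map_pmf (\<lambda>f. f c) D = Jc c"
          unfolding D_def using fin c by (simp add: Pi_pmf_component)
        finally show "measure D {f. fst (f c) < 2 * snd (f c)} \<le> 2 * (r * pmf p c) * exp (- \<kappa> / 8)"
          using Jc(3)[OF c] by simp
      qed
      also have "\<dots> = real M * exp (- \<kappa> / 8)"
        using fin by (simp add: r_def sum_pmf_eq_1 flip: sum_distrib_left sum_distrib_right)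
      \<comment> \<open>The union bound over all colours costs the factor \<open>M\<close>. Half of
        the exponent is spent on it, which is the origin of the constant 16 in
        \<open>\<kappa> \<ge> 16 * ln (real M)\<close>.\<close>
      also have "\<dots> = exp (ln (real M) - \<kappa> / 8)"
        using M_ge kappa by (simp only: diff_conv_add_uminus exp_add) simp
      also have "\<dots> \<le> exp (- \<kappa> / 16)"
        using kappa by simp
      finally show ?thesis .
    qed
    also have "measure D {f. (\<Sum>c\<in>?S. snd (f c)) < M'} \<le> exp (- \<kappa> / 16)"
    proof -
      have "measure D {f. (\<Sum>c\<in>?S. snd (f c)) < M'} = measure (map_pmf (\<lambda>f. snd \<circ> f) D) {m. (\<Sum>c\<in>set_pmf w. m c) < M'}"
        by (simp add: vimage_def setw)
      also have "\<dots> = measure (poisson_pmf q) {n. n < M'}"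
        unfolding sndD \<Lambda>_def by (rule measure_poisson_sample_counts) (simp add: setw fin)
      also have "\<dots> \<le> measure (poisson_pmf q) {n. real n \<le> real M'}"
        by (rule measure_pmf.finite_measure_mono) auto
      also have "\<dots> \<le> exp (ln 2 * real M' - q / 2)"
        by (rule poisson_lower_tail[OF q0])
      also have "\<dots> \<le> exp (- \<kappa> / 16)"
        using mult_right_mono[OF ln2_le_25_over_36, of "real M'"] M'x x_ge kappa
        by (simp only: exp_le_cancel_iff q_def) linarith
      finally show ?thesis .
    qed
    also have "exp (- \<kappa> / 16) + exp (- \<kappa> / 16) + exp (- \<kappa> / 16) = 3 * exp (- \<kappa> / 16)"
      by simp
    also have "\<dots> \<le> exp (\<kappa> / 32) * exp (- \<kappa> / 16)"
    proof (rule mult_right_mono)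
      show "3 \<le> exp (\<kappa> / 32)"
        using exp_ge_add_one_self[of "\<kappa> / 32"] kappa by linarith
    qed simp
    also have "\<dots> = exp (- \<kappa> / 32)"
      by (simp add: mult_exp_exp)
    finally show ?thesis by simp
  qed
  have J3: "(\<integral>\<^sup>+x. F (fst x) \<partial>J) \<le> (\<integral>\<^sup>+es. G es \<partial>replicate_pmf M p)"
    if FG: "\<And>V es. (\<forall>c. count_list V c \<le> count_list es c div 2) \<Longrightarrow> F V \<le> G es"
    for F G :: "'c list \<Rightarrow> ennreal"
  proof -
    \<comment> \<open>The supremum depends only on the counts of the first Poisson list, whose law
      is known, so the coupling disappears from the estimate. The variant \<open>\<Psi>\<close>
      treats a list longer than \<open>M\<close> as empty; a list of length at most \<open>M\<close>
      is realised as an initial part of the \<open>M\<close> samples.\<close>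
    define \<Phi> where "\<Phi> m = (SUP V\<in>{V. \<forall>c. count_list V c \<le> m c div 2}. F V)" for m
    define \<Psi> where "\<Psi> m = \<Phi> (if (\<Sum>c\<in>?S. m c) \<le> M then m else (\<lambda>_. 0))" for m
    have \<Phi>G: "\<Phi> m \<le> G es" if "\<And>c. m c \<le> count_list es c" for m es
      unfolding \<Phi>_def
    proof (rule SUP_least)
      fix V assume "V \<in> {V. \<forall>c. count_list V c \<le> m c div 2}"
      then show "F V \<le> G es"
        using that by (intro FG) (auto intro: order_trans[OF _ div_le_mono])
    qed
    have "(\<integral>\<^sup>+x. F (fst x) \<partial>J) = (\<integral>\<^sup>+f. \<integral>\<^sup>+W. F (if ok f then W else []) \<partial>H (snd \<circ> f) \<partial>D)"
      unfolding J_def by simp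
    also have "\<dots> \<le> (\<integral>\<^sup>+f. \<integral>\<^sup>+W. \<Psi> (fst \<circ> f) \<partial>H (snd \<circ> f) \<partial>D)"
    proof (intro nn_integral_mono_AE AE_pmfI)
      fix f W assume f: "f \<in> set_pmf D" and W: "W \<in> set_pmf (H (snd \<circ> f))"
      have "F V \<le> \<Phi> m" if "\<And>c. count_list V c \<le> m c div 2" for V m
        unfolding \<Phi>_def by (rule SUP_upper) (use that in simp)
      moreover have "count_list W c \<le> fst (f c) div 2" if ok: "ok f" for c
      proof -
        have m: "snd \<circ> f \<in> set_pmf (map_pmf count_list \<Lambda>)"
          unfolding sndD[symmetric] using f by auto
        then have "set_pmf \<Lambda> \<inter> {xs. count_list xs = snd \<circ> f} \<noteq> {}"
          by auto
        then obtain xs where xs: "count_list xs = snd \<circ> f" "W = take M' xs"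
          using W ok by (auto simp: H_def ok_def)
        have "count_list W c \<le> snd (f c)"
          using count_list_take_le[of M' xs c] xs by simp
        also have "\<dots> \<le> fst (f c) div 2"
        proof (cases "c \<in> ?S")
          case True
          then have "2 * snd (f c) \<le> fst (f c)" using ok by (simp add: ok_def)
          then show ?thesis by linarith
        next
          case False
          then have "f c = (0, 0)"
            using f set_Pi_pmf_subset[OF fin, of "(0, 0)" Jc] by (auto simp: D_def)
          then show ?thesis by simp
        qed
        finally show ?thesis .
      qed
      ultimately show "F (if ok f then W else []) \<le> \<Psi> (fst \<circ> f)"
        by (auto simp: \<Psi>_def ok_def)
    qed
    also have "\<dots> = (\<integral>\<^sup>+m. \<Psi> m \<partial>map_pmf (\<lambda>f. fst \<circ> f) D)"
      by simp
    also have "\<dots> = (\<integral>\<^sup>+n. \<integral>\<^sup>+xs. \<Psi> (count_list xs) \<partial>replicate_pmf n p \<partial>poisson_pmf r)"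
      unfolding fstD poisson_sample_def by simp
    also have "\<dots> \<le> (\<integral>\<^sup>+n. (\<integral>\<^sup>+es. G es \<partial>replicate_pmf M p) \<partial>poisson_pmf r)"
    proof (rule nn_integral_mono)
      fix n
      show "(\<integral>\<^sup>+xs. \<Psi> (count_list xs) \<partial>replicate_pmf n p) \<le> (\<integral>\<^sup>+es. G es \<partial>replicate_pmf M p)"
      proof (cases "n \<le> M")
        case True
        have "(\<integral>\<^sup>+xs. \<Psi> (count_list xs) \<partial>replicate_pmf n p) =
            (\<integral>\<^sup>+xs. \<Psi> (count_list (take n xs)) \<partial>replicate_pmf M p)"
          unfolding map_take_replicate_pmf[OF True, symmetric] by simp
        also have "\<dots> \<le> (\<integral>\<^sup>+es. G es \<partial>replicate_pmf M p)"
          by (intro nn_integral_mono) (auto simp: \<Psi>_def intro!: \<Phi>G count_list_take_le)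
        finally show ?thesis .
      next
        case False
        have "(\<integral>\<^sup>+xs. \<Psi> (count_list xs) \<partial>replicate_pmf n p) = (\<integral>\<^sup>+xs. \<Phi> (\<lambda>_. 0) \<partial>replicate_pmf n p)"
          using False by (intro nn_integral_cong_AE AE_pmfI)
            (auto simp: \<Psi>_def set_replicate_pmf sum_count_list_eq_length[OF fin] in_lists_conv_set subset_iff)
        also have "\<dots> = (\<integral>\<^sup>+es. \<Phi> (\<lambda>_. 0) \<partial>replicate_pmf M p)"
          by simp
        also have "\<dots> \<le> (\<integral>\<^sup>+es. G es \<partial>replicate_pmf M p)"
          by (intro nn_integral_mono \<Phi>G) simp
        finally show ?thesis .
      qed
    qed
    also have "\<dots> = (\<integral>\<^sup>+es. G es \<partial>replicate_pmf M p)"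
      by simp
    finally show ?thesis .
  qed
  show ?thesis by (rule that[OF J1 J0 J2 J3])
qed

section \<open>Lattices\<close>

lemma invertible_of_lin_indpt_cols:
  fixes B :: "real mat"
  assumes B: "B \<in> carrier_mat n n" "distinct (cols B)"
    and indep: "\<not> module.lin_dep class_ring (module_vec TYPE(real) n) (set (cols B))"
  obtains C where "C \<in> carrier_mat n n" "B * C = 1\<^sub>m n" "C * B = 1\<^sub>m n"
proof -
  have "Determinant.det B \<noteq> 0"
    using vec_space.lin_indpt_full_rank[OF B indep] vec_space.det_rank_iff[OF B(1)] by simp
  from det_non_zero_imp_unit[OF B(1) this, unfolded Units_def, of "()"] that show ?thesis
    by (auto simp: ring_mat_def)
qed

locale real_lattice =
  fixes n :: nat and L :: "real vec set"
  assumes is_lattice: "is_lattice n L"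
begin

text \<open>\<open>C\<close> inverts the basis matrix \<open>B\<close>, so membership becomes
  integrality of coordinates. Closure, finiteness of the quotient and convergence of Gaussian sums
  all reduce to facts about integers.\<close>

lemma coordinates:
  "\<exists>B \<in> carrier_mat n n. \<exists>C \<in> carrier_mat n n. B * C = 1\<^sub>m n \<and>
     (\<forall>x. x \<in> L \<longleftrightarrow> x \<in> carrier_vec n \<and> (\<forall>i<n. vec_index (C *\<^sub>v x) i \<in> \<int>))"
proof -
  from is_lattice obtain B where B: "B \<in> carrier_mat n n" "distinct (cols B)"
      "\<not> module.lin_dep class_ring (module_vec TYPE(real) n) (set (cols B))"
    and L: "L = {B *\<^sub>v map_vec real_of_int z | z. z \<in> carrier_vec n}"
    unfolding is_lattice_def by blast
  obtain C where C: "C \<in> carrier_mat n n" "B * C = 1\<^sub>m n" "C * B = 1\<^sub>m n"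
    using invertible_of_lin_indpt_cols[OF B] .
  have "x \<in> L \<longleftrightarrow> x \<in> carrier_vec n \<and> (\<forall>i<n. vec_index (C *\<^sub>v x) i \<in> \<int>)" for x
  proof
    assume "x \<in> L"
    then obtain z where z: "z \<in> carrier_vec n" "x = B *\<^sub>v map_vec real_of_int z"
      unfolding L by blast
    have "C *\<^sub>v x = (C * B) *\<^sub>v map_vec real_of_int z"
      unfolding z by (rule assoc_mult_mat_vec[symmetric, OF C(1) B(1)]) (use z in simp)
    also have "\<dots> = map_vec real_of_int z"
      unfolding C by (rule one_mult_mat_vec) (use z in simp)
    finally show "x \<in> carrier_vec n \<and> (\<forall>i<n. vec_index (C *\<^sub>v x) i \<in> \<int>)"
      using z B by auto
  next
    assume x: "x \<in> carrier_vec n \<and> (\<forall>i<n. vec_index (C *\<^sub>v x) i \<in> \<int>)"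
    define z where "z = Matrix.vec n (\<lambda>i. \<lfloor>vec_index (C *\<^sub>v x) i\<rfloor>)"
    have "map_vec real_of_int z = C *\<^sub>v x"
    proof (rule eq_vecI)
      fix i assume "i < dim_vec (C *\<^sub>v x)"
      then have "i < n" using C by simp
      then show "vec_index (map_vec real_of_int z) i = vec_index (C *\<^sub>v x) i"
        using x by (simp add: z_def)
    qed (use C in \<open>simp add: z_def\<close>)
    then have "B *\<^sub>v map_vec real_of_int z = B *\<^sub>v (C *\<^sub>v x)" by simp
    also have "\<dots> = (B * C) *\<^sub>v x"
      by (rule assoc_mult_mat_vec[symmetric, OF B(1) C(1)]) (use x in simp)
    also have "\<dots> = x" unfolding C by (rule one_mult_mat_vec) (use x in simp)
    finally have "x = B *\<^sub>v map_vec real_of_int z" by simp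
    moreover have "z \<in> carrier_vec n" by (simp add: z_def)
    ultimately show "x \<in> L" unfolding L by blast
  qed
  with B(1) C show ?thesis by metis
qed

lemma integral_coordinates:
  "\<exists>C \<in> carrier_mat n n. \<forall>x. x \<in> L \<longleftrightarrow> x \<in> carrier_vec n \<and> (\<forall>i<n. vec_index (C *\<^sub>v x) i \<in> \<int>)"
  using coordinates by blast

lemma carrier: "x \<in> L \<Longrightarrow> x \<in> carrier_vec n"
  using integral_coordinates by blast

lemma zero_mem: "0\<^sub>v n \<in> L"
proof -
  obtain C where C: "C \<in> carrier_mat n n"
    and L: "\<And>x. x \<in> L \<longleftrightarrow> x \<in> carrier_vec n \<and> (\<forall>i<n. vec_index (C *\<^sub>v x) i \<in> \<int>)"
    using integral_coordinates by blast
  show ?thesis using C by (simp add: L)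
qed

lemma add_mem: "x \<in> L \<Longrightarrow> y \<in> L \<Longrightarrow> x + y \<in> L"
proof -
  obtain C where C: "C \<in> carrier_mat n n"
    and L: "\<And>x. x \<in> L \<longleftrightarrow> x \<in> carrier_vec n \<and> (\<forall>i<n. vec_index (C *\<^sub>v x) i \<in> \<int>)"
    using integral_coordinates by blast
  assume "x \<in> L" "y \<in> L"
  then show ?thesis using C by (auto simp: L mult_add_distrib_mat_vec[OF C])
qed

lemma diff_mem: "x \<in> L \<Longrightarrow> y \<in> L \<Longrightarrow> x - y \<in> L"
proof -
  obtain C where C: "C \<in> carrier_mat n n"
    and L: "\<And>x. x \<in> L \<longleftrightarrow> x \<in> carrier_vec n \<and> (\<forall>i<n. vec_index (C *\<^sub>v x) i \<in> \<int>)"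
    using integral_coordinates by blast
  assume "x \<in> L" "y \<in> L"
  then show ?thesis using C by (auto simp: L mult_minus_distrib_mat_vec[OF C])
qed

lemma mem_doubled_iff: "x \<in> doubled L \<longleftrightarrow> (1 / 2) \<cdot>\<^sub>v x \<in> L"
proof
  assume "x \<in> doubled L"
  then show "(1 / 2) \<cdot>\<^sub>v x \<in> L" by (auto simp: doubled_def smult_smult_assoc)
next
  assume "(1 / 2) \<cdot>\<^sub>v x \<in> L"
  then have "2 \<cdot>\<^sub>v ((1 / 2) \<cdot>\<^sub>v x) \<in> doubled L" unfolding doubled_def by blast
  then show "x \<in> doubled L" by (simp add: smult_smult_assoc)
qed

lemma doubled_carrier: "x \<in> doubled L \<Longrightarrow> x \<in> carrier_vec n"
  by (auto simp: doubled_def carrier)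

lemma doubled_subset: "x \<in> doubled L \<Longrightarrow> x \<in> L"
proof -
  assume "x \<in> doubled L"
  then have "(1 / 2) \<cdot>\<^sub>v x + (1 / 2) \<cdot>\<^sub>v x \<in> L" by (simp add: mem_doubled_iff add_mem)
  moreover have "(1 / 2) \<cdot>\<^sub>v x + (1 / 2) \<cdot>\<^sub>v x = x" by (intro eq_vecI) auto
  ultimately show ?thesis by simp
qed

lemma doubled_zero: "0\<^sub>v n \<in> doubled L"
proof -
  have "(1 / 2) \<cdot>\<^sub>v 0\<^sub>v n = (0\<^sub>v n :: real vec)" by (intro eq_vecI) auto
  then show ?thesis by (simp add: mem_doubled_iff zero_mem)
qed

lemma doubled_diff: "x \<in> doubled L \<Longrightarrow> y \<in> doubled L \<Longrightarrow> x - y \<in> doubled L"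
proof -
  assume xy: "x \<in> doubled L" "y \<in> doubled L"
  then have "(1 / 2) \<cdot>\<^sub>v (x - y) = (1 / 2) \<cdot>\<^sub>v x - (1 / 2) \<cdot>\<^sub>v y"
    using doubled_carrier[OF xy(1)] doubled_carrier[OF xy(2)] by (intro eq_vecI) (auto simp: field_simps)
  with xy show ?thesis by (simp add: mem_doubled_iff diff_mem)
qed

lemma mem_coset2_iff:
  assumes "x \<in> carrier_vec n"
  shows "y \<in> coset2 L x \<longleftrightarrow> y \<in> carrier_vec n \<and> y - x \<in> doubled L"
proof
  assume "y \<in> coset2 L x"
  then obtain d where d: "d \<in> doubled L" "y = d + x" unfolding coset2_def by blast
  have "d + x - x = d" using doubled_carrier[OF d(1)] assms by (intro eq_vecI) auto
  with d doubled_carrier[OF d(1)] assms show "y \<in> carrier_vec n \<and> y - x \<in> doubled L" by simp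
next
  assume y: "y \<in> carrier_vec n \<and> y - x \<in> doubled L"
  have "y = (y - x) + x" using y assms by (intro eq_vecI) auto
  with y show "y \<in> coset2 L x" unfolding coset2_def by blast
qed

lemma coset2_refl: "x \<in> carrier_vec n \<Longrightarrow> x \<in> coset2 L x"
  by (simp add: mem_coset2_iff doubled_zero)

lemma coset2_eq_iff:
  assumes x: "x \<in> carrier_vec n" and y: "y \<in> carrier_vec n"
  shows "coset2 L x = coset2 L y \<longleftrightarrow> y - x \<in> doubled L"
proof
  assume "coset2 L x = coset2 L y"
  then have "y \<in> coset2 L x" using coset2_refl[OF y] by simp
  then show "y - x \<in> doubled L" by (simp add: mem_coset2_iff[OF x])
next
  assume d: "y - x \<in> doubled L"
  have eq: "z - x - (y - x) = z - y" "z - y - (0\<^sub>v n - (y - x)) = z - x" if "z \<in> carrier_vec n" for z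
    using that x y by (auto intro!: eq_vecI)
  have d': "0\<^sub>v n - (y - x) \<in> doubled L" by (rule doubled_diff[OF doubled_zero d])
  have "z - x \<in> doubled L \<longleftrightarrow> z - y \<in> doubled L" if "z \<in> carrier_vec n" for z
    using doubled_diff[OF _ d, of "z - x"] doubled_diff[OF _ d', of "z - y"] eq[OF that] by auto
  then show "coset2 L x = coset2 L y"
    by (auto simp: mem_coset2_iff x y)
qed

text \<open>The parities of the integer coordinates determine the coset: equal parities make half of
  the difference integral.\<close>

lemma finite_quotient2: "finite (quotient2 L)"
proof -
  obtain C where C: "C \<in> carrier_mat n n"
    and L: "\<And>x. x \<in> L \<longleftrightarrow> x \<in> carrier_vec n \<and> (\<forall>i<n. vec_index (C *\<^sub>v x) i \<in> \<int>)"
    using integral_coordinates by blast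
  define h where "h x = (\<lambda>i\<in>{..<n}. \<lfloor>vec_index (C *\<^sub>v x) i\<rfloor> mod 2)" for x
  have fin: "finite (h ` L)"
  proof (rule finite_subset)
    show "h ` L \<subseteq> PiE {..<n} (\<lambda>_. {0, 1})" by (auto simp: h_def PiE_def extensional_def)
  qed (simp add: finite_PiE)
  have eqI: "coset2 L x = coset2 L y" if x: "x \<in> L" and y: "y \<in> L" and eq: "h x = h y" for x y
  proof -
    have "(1 / 2) \<cdot>\<^sub>v (y - x) \<in> L"
      unfolding L
    proof (intro conjI allI impI)
      show "(1 / 2) \<cdot>\<^sub>v (y - x) \<in> carrier_vec n" using x y by (simp add: carrier)
      fix i assume i: "i < n"
      have "vec_index (C *\<^sub>v ((1 / 2) \<cdot>\<^sub>v (y - x))) i = (vec_index (C *\<^sub>v y) i - vec_index (C *\<^sub>v x) i) / 2"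
        using carrier[OF x] carrier[OF y] C i
        by (simp add: mult_mat_vec[OF C] mult_minus_distrib_mat_vec[OF C])
      also have "vec_index (C *\<^sub>v y) i = real_of_int \<lfloor>vec_index (C *\<^sub>v y) i\<rfloor>"
        using y i by (simp add: L)
      also have "vec_index (C *\<^sub>v x) i = real_of_int \<lfloor>vec_index (C *\<^sub>v x) i\<rfloor>"
        using x i by (simp add: L)
      also have "(real_of_int \<lfloor>vec_index (C *\<^sub>v y) i\<rfloor> - real_of_int \<lfloor>vec_index (C *\<^sub>v x) i\<rfloor>) / 2 =
          real_of_int ((\<lfloor>vec_index (C *\<^sub>v y) i\<rfloor> - \<lfloor>vec_index (C *\<^sub>v x) i\<rfloor>) div 2)"
      proof -
        have "\<lfloor>vec_index (C *\<^sub>v x) i\<rfloor> mod 2 = \<lfloor>vec_index (C *\<^sub>v y) i\<rfloor> mod 2"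
          using fun_cong[OF eq, of i] i by (simp add: h_def)
        then have "2 dvd \<lfloor>vec_index (C *\<^sub>v y) i\<rfloor> - \<lfloor>vec_index (C *\<^sub>v x) i\<rfloor>"
          by (simp add: mod_eq_dvd_iff dvd_diff_commute)
        then obtain k where "\<lfloor>vec_index (C *\<^sub>v y) i\<rfloor> - \<lfloor>vec_index (C *\<^sub>v x) i\<rfloor> = 2 * k"
          by (rule dvdE)
        then show ?thesis by (simp flip: of_int_diff)
      qed
      finally show "vec_index (C *\<^sub>v ((1 / 2) \<cdot>\<^sub>v (y - x))) i \<in> \<int>" by simp
    qed
    then show ?thesis using x y by (simp add: coset2_eq_iff carrier mem_doubled_iff)
  qed
  have "coset2 L x = coset2 L (inv_into L h (h x))" if "x \<in> L" for x
    by (rule eqI) (use that in \<open>simp_all add: f_inv_into_f inv_into_into\<close>)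
  then have "coset2 L ` L \<subseteq> (\<lambda>k. coset2 L (inv_into L h k)) ` (h ` L)"
    by blast
  then show ?thesis
    unfolding quotient2_def by (rule finite_subset) (use fin in simp)
qed

end

section \<open>Discrete probability\<close>

lemma nn_integral_count_space_infsum:
  fixes f :: "'a \<Rightarrow> real"
  assumes "f summable_on A" "\<And>x. x \<in> A \<Longrightarrow> 0 \<le> f x"
  shows "(\<integral>\<^sup>+x. ennreal (f x) \<partial>count_space A) = ennreal (infsum f A)"
proof -
  have "(\<lambda>x. norm (f x)) summable_on A"
    using assms by (subst summable_on_cong[of A _ f]) auto
  then have "Infinite_Set_Sum.abs_summable_on f A"
    using abs_summable_equivalent by blast
  then show ?thesis
    using nn_integral_conv_infsetsum[of f A] assms(2) by (simp add: infsetsum_infsum)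
qed

lemma pmf_summable_on: "pmf p summable_on A"
proof -
  have "(\<lambda>x. norm (pmf p x)) summable_on A"
    using abs_summable_equivalent pmf_abs_summable by blast
  then show ?thesis by simp
qed

lemma infsum_pmf: "infsum (pmf p) A = measure p A"
  unfolding measure_pmf_conv_infsetsum by (rule infsetsum_infsum[symmetric, OF pmf_abs_summable])

text \<open>The two marginals share the mass on the diagonal. Off the diagonal each has total mass
  equal to the probability of disagreement, and the factor 1/2 in the distance compensates for
  counting it twice.\<close>

lemma statistical_distance_le_coupling:
  "statistical_distance (map_pmf fst J) (map_pmf snd J) \<le> measure J {(x, y). x \<noteq> y}"
proof -
  \<comment> \<open>The off-diagonal part of a marginal is a subprobability; sending the diagonal to
    \<open>None\<close> makes a pmf of it, for which summability is known.\<close>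
  define H where "H f = map_pmf (\<lambda>z. if fst z \<noteq> snd z then Some (f z) else None) J" for f :: "'a \<times> 'a \<Rightarrow> 'a"
  have pmfH: "pmf (H f) (Some x) = measure J {z. fst z \<noteq> snd z \<and> f z = x}" for f x
    unfolding H_def pmf_map by (rule arg_cong[where f = "measure J"]) (auto split: if_splits)
  have sumH: "(\<lambda>x. pmf (H f) (Some x)) summable_on UNIV"
    "infsum (\<lambda>x. pmf (H f) (Some x)) UNIV = measure J {(x, y). x \<noteq> y}" for f
  proof -
    have "pmf (H f) summable_on range Some" by (rule pmf_summable_on)
    then show "(\<lambda>x. pmf (H f) (Some x)) summable_on UNIV"
      by (subst (asm) summable_on_reindex) (auto simp: o_def)
    have "infsum (\<lambda>x. pmf (H f) (Some x)) UNIV = infsum (pmf (H f)) (range Some)"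
      by (subst infsum_reindex) (auto simp: o_def)
    also have "\<dots> = measure J {(x, y). x \<noteq> y}"
      unfolding infsum_pmf unfolding H_def
      by (simp, rule arg_cong[where f = "measure J"]) (auto split: if_splits)
    finally show "infsum (\<lambda>x. pmf (H f) (Some x)) UNIV = measure J {(x, y). x \<noteq> y}" .
  qed
  have bound: "\<bar>pmf (map_pmf fst J) x - pmf (map_pmf snd J) x\<bar> \<le> pmf (H fst) (Some x) + pmf (H snd) (Some x)" for x
  proof -
    have split: "pmf (map_pmf f J) x = measure J {z. fst z = snd z \<and> fst z = x} + pmf (H f) (Some x)"
      if "f = fst \<or> f = snd" for f
    proof -
      have "pmf (map_pmf f J) x = measure J ({z. fst z = snd z \<and> fst z = x} \<union> {z. fst z \<noteq> snd z \<and> f z = x})"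
        unfolding pmf_map using that by (intro arg_cong[where f = "measure J"]) auto
      also have "\<dots> = measure J {z. fst z = snd z \<and> fst z = x} + measure J {z. fst z \<noteq> snd z \<and> f z = x}"
        by (rule measure_pmf.finite_measure_Union) auto
      finally show ?thesis by (simp add: pmfH)
    qed
    show ?thesis
      using split[OF disjI1[OF refl]] split[OF disjI2[OF refl]] pmf_nonneg[of "H fst" "Some x"] pmf_nonneg[of "H snd" "Some x"] by linarith
  qed
  have "infsum (\<lambda>x. \<bar>pmf (map_pmf fst J) x - pmf (map_pmf snd J) x\<bar>) UNIV \<le>
      infsum (\<lambda>x. pmf (H fst) (Some x) + pmf (H snd) (Some x)) UNIV"
  proof (rule infsum_mono)
    show *: "(\<lambda>x. pmf (H fst) (Some x) + pmf (H snd) (Some x)) summable_on UNIV"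
      by (intro summable_on_add sumH)
    show "(\<lambda>x. \<bar>pmf (map_pmf fst J) x - pmf (map_pmf snd J) x\<bar>) summable_on UNIV"
      by (rule summable_on_comparison_test[OF *]) (use bound in auto)
  qed (rule bound)
  also have "\<dots> = 2 * measure J {(x, y). x \<noteq> y}"
    by (subst infsum_add) (auto simp: sumH)
  finally show ?thesis
    unfolding statistical_distance_def by simp
qed

text \<open>Where the inputs agree, one common draw from \<open>f\<close> serves both sides; where
  they differ, independent draws do. So the outputs differ only if the inputs do.\<close>

lemma statistical_distance_bind_le:
  "statistical_distance (bind_pmf J (\<lambda>x. f (fst x))) (bind_pmf J (\<lambda>x. f (snd x))) \<le> measure J {(x, y). x \<noteq> y}"
proof -
  define K where "K = bind_pmf J (\<lambda>(x, y). if x = y then map_pmf (\<lambda>z. (z, z)) (f x) else pair_pmf (f x) (f y))"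
  have "map_pmf fst K = bind_pmf J (\<lambda>x. f (fst x))" "map_pmf snd K = bind_pmf J (\<lambda>x. f (snd x))"
    unfolding K_def map_bind_pmf
    by (auto intro!: bind_pmf_cong simp: pmf.map_comp o_def map_fst_pair_pmf map_snd_pair_pmf split: prod.splits)
  moreover have "measure K {(x, y). x \<noteq> y} \<le> measure J {(x, y). x \<noteq> y}"
  proof -
    have "emeasure K {(x, y). x \<noteq> y} = (\<integral>\<^sup>+x. indicator {(x, y). x \<noteq> y} x \<partial>K)"
      by simp
    also have "\<dots> \<le> (\<integral>\<^sup>+x. indicator {(x, y). x \<noteq> y} x \<partial>J)"
      unfolding K_def nn_integral_bind_pmf
    proof (rule nn_integral_mono)
      fix x
      show "(\<integral>\<^sup>+y. indicator {(x, y). x \<noteq> y} y \<partial>(case x of (x, y) \<Rightarrow>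
          if x = y then map_pmf (\<lambda>z. (z, z)) (f x) else pair_pmf (f x) (f y))) \<le> (indicator {(x, y). x \<noteq> y} x :: ennreal)"
        by (cases x) (auto simp: measure_pmf.emeasure_le_1)
    qed
    also have "\<dots> = emeasure J {(x, y). x \<noteq> y}" by simp
    finally show ?thesis by (simp add: measure_pmf.emeasure_eq_measure)
  qed
  ultimately show ?thesis
    using statistical_distance_le_coupling[of K] by simp
qed

text \<open>Both total masses are 1. Laws can thus be identified up to normalisation, and the second
  conclusion turns such an identification into an identity of normalising constants.\<close>

lemma pmf_proportional:
  assumes "\<And>x. pmf P x = c * pmf Q x"
  shows "P = Q" "c = 1"
proof -
  have "measure P UNIV = infsum (\<lambda>x. c * pmf Q x) UNIV"
    unfolding infsum_pmf[symmetric] by (rule infsum_cong) (rule assms)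
  also have "\<dots> = c * measure Q UNIV"
    unfolding infsum_pmf[symmetric] by (rule infsum_cmult_right) (rule pmf_summable_on)
  finally show "c = 1" by simp
  with assms show "P = Q" by (intro pmf_eqI) simp
qed

lemma rho_pos: "0 < rho s x"
  by (simp add: rho_def)

lemma rho_set_pos:
  assumes "rho s summable_on A" "A \<noteq> {}"
  shows "0 < rho_set s A"
proof -
  obtain a where a: "a \<in> A" using assms by blast
  have "infsum (rho s) {a} \<le> infsum (rho s) A"
    by (rule infsum_mono_neutral) (use a assms in \<open>auto intro: less_imp_le[OF rho_pos]\<close>)
  then show ?thesis using rho_pos[of s a] unfolding rho_set_def by simp
qed

lemma pmf_discrete_gaussian:
  assumes "rho s summable_on A" "A \<noteq> {}"
  shows "pmf (discrete_gaussian A s) x = (if x \<in> A then rho s x / rho_set s A else 0)"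
  unfolding discrete_gaussian_def
proof (rule pmf_embed_pmf)
  note pos = rho_set_pos[OF assms]
  show "0 \<le> (if x \<in> A then rho s x / rho_set s A else 0)" for x
    using pos rho_pos[of s x] by simp
  have "(\<integral>\<^sup>+x. ennreal (if x \<in> A then rho s x / rho_set s A else 0) \<partial>count_space UNIV) =
      (\<integral>\<^sup>+x. ennreal (rho s x * (1 / rho_set s A)) \<partial>count_space A)"
    by (subst (2) nn_integral_count_space_indicator) (auto intro!: nn_integral_cong simp: indicator_def)
  also have "\<dots> = ennreal (infsum (\<lambda>x. rho s x * (1 / rho_set s A)) A)"
    using pos assms by (intro nn_integral_count_space_infsum summable_on_cmult_left) (auto intro!: divide_nonneg_pos less_imp_le[OF rho_pos])
  also have "infsum (\<lambda>x. rho s x * (1 / rho_set s A)) A = 1"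
    using assms pos by (subst infsum_cmult_left) (auto simp: rho_set_def)
  finally show "(\<integral>\<^sup>+x. ennreal (if x \<in> A then rho s x / rho_set s A else 0) \<partial>count_space UNIV) = 1"
    by simp
qed

lemma set_discrete_gaussian:
  assumes "rho s summable_on A" "A \<noteq> {}"
  shows "set_pmf (discrete_gaussian A s) = A"
  using rho_set_pos[OF assms] less_imp_neq[OF rho_pos, of s]
  by (auto simp: set_pmf_iff pmf_discrete_gaussian[OF assms] split: if_splits)

section \<open>Gaussian sums over shifted lattices\<close>

text \<open>A geometric variable with a random sign: 1/4 is the product of the sign probability and
  the geometric parameter, and equality fails only at 0, which arises from both signs. It serves as
  a summable majorant for Gaussian weights.\<close>

lemma exists_int_pmf_ge_geometric:
  "\<exists>P :: int pmf. \<forall>k. 1 / 4 * (1 / 2) ^ nat \<bar>k\<bar> \<le> pmf P k"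
proof -
  define f where "f = (\<lambda>(b, m). if b then int m else - int m)"
  define p where "p = pair_pmf (bernoulli_pmf (1 / 2)) (geometric_pmf (1 / 2))"
  have "1 / 4 * (1 / 2) ^ nat \<bar>k\<bar> \<le> pmf (map_pmf f p) k" for k
  proof -
    have k: "f (0 \<le> k, nat \<bar>k\<bar>) = k" by (simp add: f_def)
    have "1 / 4 * (1 / 2) ^ nat \<bar>k\<bar> = pmf p (0 \<le> k, nat \<bar>k\<bar>)"
      by (cases "0 \<le> k") (simp_all add: p_def pmf_pair)
    also have "\<dots> = measure p {(0 \<le> k, nat \<bar>k\<bar>)}" by (simp add: measure_pmf_single)
    also have "\<dots> \<le> measure p (f -` {k})"
      by (rule measure_pmf.finite_measure_mono) (use k in auto)
    finally show ?thesis by (simp add: pmf_map)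
  qed
  then show ?thesis by blast
qed

lemma completing_square_bound:
  fixes \<alpha> \<beta> y :: real
  assumes "\<alpha> > 0"
  shows "- \<alpha> * y\<^sup>2 \<le> \<beta>\<^sup>2 / (4 * \<alpha>) - \<beta> * y"
proof -
  have "0 \<le> \<alpha> * (y - \<beta> / (2 * \<alpha>))\<^sup>2" using assms by simp
  also have "\<dots> = \<alpha> * y\<^sup>2 - \<beta> * y + \<beta>\<^sup>2 / (4 * \<alpha>)"
    using assms by (simp add: power2_eq_square field_simps)
  finally show ?thesis by simp
qed

lemma scalar_prod_self: "x \<in> carrier_vec n \<Longrightarrow> scalar_prod x x = (\<Sum>i<n. (vec_index x i)\<^sup>2)" for x :: "real vec"
  by (simp add: scalar_prod_def power2_eq_square atLeast0LessThan carrier_vecD)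

text \<open>The factor 2 in the parallelogram law for squared norms is what changes the parameter
  \<open>s\<close> into \<open>s / sqrt 2\<close>.\<close>

lemma rho_parallelogram:
  assumes "u \<in> carrier_vec n" "v \<in> carrier_vec n"
  shows "rho s (u + v) * rho s (u - v) = rho (s / sqrt 2) u * rho (s / sqrt 2) v"
proof -
  note dims = carrier_vecD[OF assms(1)] carrier_vecD[OF assms(2)]
  have "scalar_prod (u + v) (u + v) + scalar_prod (u - v) (u - v) =
      (\<Sum>i<n. (vec_index u i + vec_index v i)\<^sup>2 + (vec_index u i - vec_index v i)\<^sup>2)"
    using assms dims by (simp add: scalar_prod_self[of _ n] sum.distrib)
  also have "\<dots> = (\<Sum>i<n. 2 * ((vec_index u i)\<^sup>2 + (vec_index v i)\<^sup>2))"
    by (intro sum.cong refl) (simp add: power2_eq_square algebra_simps)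
  also have "\<dots> = 2 * (scalar_prod u u + scalar_prod v v)"
    unfolding scalar_prod_self[OF assms(1)] scalar_prod_self[OF assms(2)]
    by (simp only: sum_distrib_left sum.distrib distrib_left)
  finally have "scalar_prod (u + v) (u + v) + scalar_prod (u - v) (u - v) = 2 * (scalar_prod u u + scalar_prod v v)" .
  then have "- pi * scalar_prod (u + v) (u + v) / s\<^sup>2 + - pi * scalar_prod (u - v) (u - v) / s\<^sup>2 =
      - pi * (2 * (scalar_prod u u + scalar_prod v v)) / s\<^sup>2"
    by (simp only: add_divide_distrib[symmetric] distrib_left[symmetric])
  also have "\<dots> = - pi * scalar_prod u u / (s / sqrt 2)\<^sup>2 + - pi * scalar_prod v v / (s / sqrt 2)\<^sup>2"
    by (simp add: power_divide add_divide_distrib[symmetric] algebra_simps)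
  finally show ?thesis
    unfolding rho_def mult_exp_exp by simp
qed

locale gaussian_lattice = real_lattice +
  fixes t :: "real vec" and s :: real
  assumes t: "t \<in> carrier_vec n" and s: "s > 0"
begin

lemma mem_shift_by_iff: "x \<in> shift_by L t \<longleftrightarrow> x \<in> carrier_vec n \<and> x + t \<in> L"
proof
  assume "x \<in> shift_by L t"
  then obtain l where l: "l \<in> L" "x = l - t" unfolding shift_by_def by blast
  have "l - t + t = l" using carrier[OF l(1)] t by (intro eq_vecI) auto
  with l t carrier[OF l(1)] show "x \<in> carrier_vec n \<and> x + t \<in> L" by simp
next
  assume x: "x \<in> carrier_vec n \<and> x + t \<in> L"
  have "x = (x + t) - t" using x t by (intro eq_vecI) auto
  with x show "x \<in> shift_by L t" unfolding shift_by_def by blast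
qed

lemma shift_by_carrier: "x \<in> shift_by L t \<Longrightarrow> x \<in> carrier_vec n"
  by (simp add: mem_shift_by_iff)

text \<open>The quadratic exponent beats any linear function of the integer coordinates, so the
  weight is at most a constant times a product of two-sided geometric masses at these coordinates.
  As the coordinates determine the point, summability of a pmf suffices.\<close>

lemma rho_summable_on_shift:
  assumes r: "r > 0"
  shows "rho r summable_on shift_by L t"
proof -
  obtain B C where B: "B \<in> carrier_mat n n" and C: "C \<in> carrier_mat n n" and BC: "B * C = 1\<^sub>m n"
    and L: "\<And>x. x \<in> L \<longleftrightarrow> x \<in> carrier_vec n \<and> (\<forall>i<n. vec_index (C *\<^sub>v x) i \<in> \<int>)"
    using coordinates by blast
  obtain P :: "int pmf" where P: "\<And>k. 1 / 4 * (1 / 2) ^ nat \<bar>k\<bar> \<le> pmf P k"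
    using exists_int_pmf_ge_geometric by blast
  define Q where "Q = Pi_pmf {..<n} 0 (\<lambda>_. P)"
  define h where "h x = (\<lambda>i. if i < n then \<lfloor>vec_index (C *\<^sub>v (x + t)) i\<rfloor> else 0)" for x
  \<comment> \<open>\<open>a j\<close> bounds the influence of the j-th entry on the sum of the
    absolute coordinates; \<open>b\<close> collects what the completed squares and the shift
    \<open>t\<close> leave over.\<close>
  define a where "a j = (\<Sum>i<n. \<bar>C $$ (i, j)\<bar>)" for j
  define b where "b = (\<Sum>j<n. (ln 2 * a j)\<^sup>2 / (4 * (pi / r\<^sup>2)) + ln 2 * a j * \<bar>vec_index t j\<bar>)"
  have hx: "real_of_int (h x i) = vec_index (C *\<^sub>v (x + t)) i" if "x \<in> shift_by L t" "i < n" for x i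
    using that by (simp add: mem_shift_by_iff L h_def)
  have inj: "inj_on h (shift_by L t)"
  proof (rule inj_onI)
    fix x y assume x: "x \<in> shift_by L t" and y: "y \<in> shift_by L t" and eq: "h x = h y"
    have "C *\<^sub>v (x + t) = C *\<^sub>v (y + t)"
      by (rule eq_vecI) (use C hx[OF x] hx[OF y] eq in \<open>auto simp flip: hx[OF x] hx[OF y]\<close>)
    then have "(B * C) *\<^sub>v (x + t) = (B * C) *\<^sub>v (y + t)"
      using x y t by (simp add: assoc_mult_mat_vec[OF B C] shift_by_carrier)
    then have xy: "x + t = y + t"
      using x y t by (simp add: BC shift_by_carrier)
    have "x = (x + t) - t" "y = (y + t) - t"
      using shift_by_carrier[OF x] shift_by_carrier[OF y] t by (auto intro!: eq_vecI)
    with xy show "x = y" by metis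
  qed
  have bound: "rho r x \<le> exp b * 4 ^ n * pmf Q (h x)" if x: "x \<in> shift_by L t" for x
  proof -
    have xc: "x \<in> carrier_vec n" using x by (rule shift_by_carrier)
    have "(\<Sum>i<n. \<bar>real_of_int (h x i)\<bar>) \<le> (\<Sum>i<n. \<Sum>j<n. \<bar>C $$ (i, j)\<bar> * (\<bar>vec_index x j\<bar> + \<bar>vec_index t j\<bar>))"
    proof (rule sum_mono)
      fix i assume "i \<in> {..<n}"
      then have i: "i < n" by simp
      have "real_of_int (h x i) = (\<Sum>j<n. C $$ (i, j) * (vec_index x j + vec_index t j))"
        unfolding hx[OF x i] using C xc t i by (simp add: scalar_prod_def atLeast0LessThan)
      also have "\<bar>\<dots>\<bar> \<le> (\<Sum>j<n. \<bar>C $$ (i, j) * (vec_index x j + vec_index t j)\<bar>)" by (rule sum_abs)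
      also have "\<dots> \<le> (\<Sum>j<n. \<bar>C $$ (i, j)\<bar> * (\<bar>vec_index x j\<bar> + \<bar>vec_index t j\<bar>))"
        unfolding abs_mult by (intro sum_mono mult_left_mono abs_triangle_ineq) auto
      finally show "\<bar>real_of_int (h x i)\<bar> \<le> (\<Sum>j<n. \<bar>C $$ (i, j)\<bar> * (\<bar>vec_index x j\<bar> + \<bar>vec_index t j\<bar>))" .
    qed
    also have "\<dots> = (\<Sum>j<n. a j * (\<bar>vec_index x j\<bar> + \<bar>vec_index t j\<bar>))"
      unfolding a_def sum_distrib_right by (rule sum.swap)
    finally have hsum: "(\<Sum>i<n. \<bar>real_of_int (h x i)\<bar>) \<le> (\<Sum>j<n. a j * (\<bar>vec_index x j\<bar> + \<bar>vec_index t j\<bar>))" .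
    have "- pi * scalar_prod x x / r\<^sup>2 = (\<Sum>j<n. - (pi / r\<^sup>2) * \<bar>vec_index x j\<bar>\<^sup>2)"
      by (simp add: scalar_prod_self[OF xc] sum_distrib_left sum_divide_distrib sum_negf)
    also have "\<dots> \<le> (\<Sum>j<n. (ln 2 * a j)\<^sup>2 / (4 * (pi / r\<^sup>2)) - (ln 2 * a j) * \<bar>vec_index x j\<bar>)"
      using r by (intro sum_mono completing_square_bound) simp
    also have "\<dots> = b - ln 2 * (\<Sum>j<n. a j * (\<bar>vec_index x j\<bar> + \<bar>vec_index t j\<bar>))"
      unfolding b_def by (simp add: sum_distrib_left sum_subtractf sum.distrib algebra_simps)
    also have "\<dots> \<le> b - ln 2 * (\<Sum>i<n. \<bar>real_of_int (h x i)\<bar>)"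
      using mult_left_mono[OF hsum, of "ln 2"] by simp
    finally have "rho r x \<le> exp (b - ln 2 * (\<Sum>i<n. \<bar>real_of_int (h x i)\<bar>))"
      unfolding rho_def by simp
    also have "\<dots> = exp b * (\<Prod>i<n. exp (- (ln 2 * \<bar>real_of_int (h x i)\<bar>)))"
    proof -
      have "b - ln 2 * (\<Sum>i<n. \<bar>real_of_int (h x i)\<bar>) = b + (\<Sum>i<n. - (ln 2 * \<bar>real_of_int (h x i)\<bar>))"
        by (simp add: sum_negf sum_distrib_left)
      then show ?thesis by (simp only: exp_add exp_sum[OF finite_lessThan])
    qed
    also have "(\<Prod>i<n. exp (- (ln 2 * \<bar>real_of_int (h x i)\<bar>))) \<le> (\<Prod>i<n. 4 * pmf P (h x i))"
    proof (intro prod_mono conjI)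
      fix i
      have "exp (- (ln 2 * \<bar>real_of_int (h x i)\<bar>)) = exp (- ln 2) ^ nat \<bar>h x i\<bar>"
        by (simp flip: exp_of_nat_mult)
      also have "\<dots> = (1 / 2) ^ nat \<bar>h x i\<bar>" by (simp add: exp_minus)
      also have "\<dots> \<le> 4 * pmf P (h x i)" using P[of "h x i"] by simp
      finally show "exp (- (ln 2 * \<bar>real_of_int (h x i)\<bar>)) \<le> 4 * pmf P (h x i)" .
    qed simp
    also have "\<dots> = 4 ^ n * pmf Q (h x)"
      unfolding Q_def by (subst pmf_Pi') (auto simp: h_def prod.distrib)
    finally show ?thesis by simp
  qed
  have "pmf Q \<circ> h summable_on shift_by L t"
    using pmf_summable_on[of Q "h ` shift_by L t"] by (simp add: summable_on_reindex[OF inj])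
  then have "(\<lambda>x. exp b * 4 ^ n * pmf Q (h x)) summable_on shift_by L t"
    by (intro summable_on_cmult_right) (simp add: o_def)
  then show ?thesis
    by (rule summable_on_comparison_test) (use bound rho_pos[of r] in \<open>auto intro: less_imp_le\<close>)
qed

end

section \<open>Cosets of the shifted lattice and the Gaussians on them\<close>

context gaussian_lattice
begin

abbreviation X where "X \<equiv> shift_by L t"
abbreviation cosets where "cosets \<equiv> shifted_quotient2 L t"

lemma X_nonempty: "X \<noteq> {}"
  using zero_mem by (auto simp: shift_by_def)

lemma add_mem_X: "x \<in> X \<Longrightarrow> v \<in> L \<Longrightarrow> x + v \<in> X"
proof -
  assume x: "x \<in> X" and v: "v \<in> L"
  have "x + v + t = (x + t) + v"
    using shift_by_carrier[OF x] carrier[OF v] t by (intro eq_vecI) auto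
  then show ?thesis using x v carrier[OF v] by (simp add: mem_shift_by_iff add_mem)
qed

lemma shift_coset2:
  assumes "l \<in> L"
  shows "shift_by (coset2 L l) t = coset2 L (l - t)"
proof -
  have l: "l \<in> carrier_vec n" using assms by (rule carrier)
  have "d + l - t = d + (l - t)" if "d \<in> doubled L" for d
    using doubled_carrier[OF that] l t by (intro eq_vecI) auto
  then show ?thesis
    unfolding shift_by_def coset2_def image_image by (intro image_cong) auto
qed

lemma cosets_eq: "cosets = coset2 L ` X"
  unfolding shifted_quotient2_def quotient2_def image_image
  unfolding shift_by_def[of L] image_image by (intro image_cong refl) (rule shift_coset2)

lemma finite_cosets: "finite cosets"
  unfolding shifted_quotient2_def by (intro finite_imageI finite_quotient2)

lemma cosets_nonempty: "cosets \<noteq> {}"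
  using X_nonempty by (simp add: cosets_eq)

lemma coset2_mem_cosets: "x \<in> X \<Longrightarrow> coset2 L x \<in> cosets"
  by (simp add: cosets_eq)

lemma mem_coset_iff:
  assumes "K \<in> cosets"
  shows "x \<in> K \<longleftrightarrow> x \<in> X \<and> coset2 L x = K"
proof -
  obtain k where k: "k \<in> X" "K = coset2 L k" using assms by (auto simp: cosets_eq)
  have kc: "k \<in> carrier_vec n" using k(1) by (rule shift_by_carrier)
  show ?thesis
  proof
    assume "x \<in> K"
    then have x: "x \<in> carrier_vec n" "x - k \<in> doubled L" by (auto simp: k mem_coset2_iff[OF kc])
    have "k + (x - k) \<in> X" using k(1) x(2) by (intro add_mem_X doubled_subset)
    moreover have "k + (x - k) = x" using x kc by (intro eq_vecI) auto
    ultimately show "x \<in> X \<and> coset2 L x = K"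
      using x coset2_eq_iff[OF kc x(1)] by (simp add: k(2))
  next
    assume "x \<in> X \<and> coset2 L x = K"
    then show "x \<in> K" using coset2_refl shift_by_carrier by blast
  qed
qed

lemma coset_subset: "K \<in> cosets \<Longrightarrow> K \<subseteq> X"
  by (auto simp: mem_coset_iff)

lemma coset_nonempty: "K \<in> cosets \<Longrightarrow> K \<noteq> {}"
  using coset2_refl shift_by_carrier by (auto simp: cosets_eq)

lemma same_coset_iff: "x \<in> X \<Longrightarrow> y \<in> X \<Longrightarrow> y - x \<in> doubled L \<longleftrightarrow> coset2 L y = coset2 L x"
  using coset2_eq_iff shift_by_carrier by metis

lemma rho_summable_on_coset: "r > 0 \<Longrightarrow> K \<in> cosets \<Longrightarrow> rho r summable_on K"
  by (rule summable_on_subset_banach[OF rho_summable_on_shift coset_subset])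

lemma pmf_gaussian_X:
  "r > 0 \<Longrightarrow> pmf (discrete_gaussian X r) x = (if x \<in> X then rho r x / rho_set r X else 0)"
  by (intro pmf_discrete_gaussian rho_summable_on_shift X_nonempty)

lemma pmf_gaussian_coset:
  "r > 0 \<Longrightarrow> K \<in> cosets \<Longrightarrow> pmf (discrete_gaussian K r) x = (if x \<in> K then rho r x / rho_set r K else 0)"
  by (intro pmf_discrete_gaussian rho_summable_on_coset coset_nonempty)

lemma set_gaussian_coset: "r > 0 \<Longrightarrow> K \<in> cosets \<Longrightarrow> set_pmf (discrete_gaussian K r) = K"
  by (intro set_discrete_gaussian rho_summable_on_coset coset_nonempty)

lemma set_gaussian_X: "r > 0 \<Longrightarrow> set_pmf (discrete_gaussian X r) = X"
  by (intro set_discrete_gaussian rho_summable_on_shift X_nonempty)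

lemma rho_set_coset_pos: "r > 0 \<Longrightarrow> K \<in> cosets \<Longrightarrow> 0 < rho_set r K"
  by (intro rho_set_pos rho_summable_on_coset coset_nonempty)

lemma rho_set_X_pos: "r > 0 \<Longrightarrow> 0 < rho_set r X"
  by (intro rho_set_pos rho_summable_on_shift X_nonempty)

text \<open>On a single coset the factor \<open>\<phi>\<close> is constant, so the conditional law
  of \<open>A\<close> there is proportional to \<open>rho r\<close> and hence the discrete Gaussian.
  It applies to the inputs with constant \<open>\<phi>\<close>, and to the averages, where
  \<open>\<phi>\<close> is a genuine function of the coset.\<close>

lemma bind_coset_gaussian:
  assumes r: "r > 0" and A: "set_pmf A \<subseteq> X"
    and pmf: "\<And>u. u \<in> X \<Longrightarrow> pmf A u = rho r u * \<phi> u"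
    and \<phi>: "\<And>u u'. u \<in> X \<Longrightarrow> u' \<in> X \<Longrightarrow> coset2 L u = coset2 L u' \<Longrightarrow> \<phi> u = \<phi> u'"
  shows "bind_pmf (map_pmf (coset2 L) A) (\<lambda>K. discrete_gaussian K r) = A"
proof -
  have "bind_pmf (map_pmf (coset2 L) A) (\<lambda>K. discrete_gaussian K r) =
      bind_pmf (map_pmf (coset2 L) A) (\<lambda>K. bind_pmf (cond_pmf A {x. coset2 L x = K}) return_pmf)"
  proof (intro bind_pmf_cong refl)
    fix K assume "K \<in> set_pmf (map_pmf (coset2 L) A)"
    then obtain u0 where u0: "u0 \<in> set_pmf A" "K = coset2 L u0" by auto
    then have K: "K \<in> cosets" using A coset2_mem_cosets by blast
    have ne: "set_pmf A \<inter> {x. coset2 L x = K} \<noteq> {}" using u0 by blast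
    have "cond_pmf A {x. coset2 L x = K} = discrete_gaussian K r"
    proof (rule pmf_proportional(1))
      fix x
      show "pmf (cond_pmf A {x. coset2 L x = K}) x =
          (\<phi> u0 * rho_set r K / measure A {x. coset2 L x = K}) * pmf (discrete_gaussian K r) x"
      proof (cases "x \<in> K")
        case True
        then have x: "x \<in> X" "coset2 L x = K" by (auto simp: mem_coset_iff[OF K])
        moreover have "\<phi> x = \<phi> u0" by (rule \<phi>) (use x u0 A in auto)
        ultimately show ?thesis
          using True pmf[of x] rho_set_coset_pos[OF r K]
          by (simp add: pmf_cond[OF ne] pmf_gaussian_coset[OF r K])
      next
        case False
        then have "x \<notin> X \<or> coset2 L x \<noteq> K" by (auto simp: mem_coset_iff[OF K])
        then have "pmf (cond_pmf A {x. coset2 L x = K}) x = 0"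
          using A by (auto simp: pmf_cond[OF ne] pmf_eq_0_set_pmf)
        then show ?thesis using False by (simp add: pmf_gaussian_coset[OF r K])
      qed
    qed
    then show "discrete_gaussian K r = bind_pmf (cond_pmf A {x. coset2 L x = K}) return_pmf"
      by (simp add: bind_return_pmf')
  qed
  also have "\<dots> = A"
    by (subst bind_map_cond_pmf) (simp add: bind_return_pmf')
  finally show ?thesis .
qed

definition average_law :: "real vec set \<Rightarrow> real vec pmf" where
  "average_law K = map_pmf (\<lambda>(x, y). (1 / 2) \<cdot>\<^sub>v (x + y)) (pair_pmf (discrete_gaussian K s) (discrete_gaussian K s))"

lemma s': "s / sqrt 2 > 0"
  using s by simp

lemma sum_mem_coset:
  assumes "K \<in> cosets" "x \<in> K" "d \<in> doubled L"
  shows "x + d \<in> K"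
proof -
  have x: "x \<in> X" "coset2 L x = K" using assms mem_coset_iff by auto
  have "x + d \<in> X" using x(1) assms(3) by (intro add_mem_X doubled_subset)
  moreover have "x + d - x = d"
    using shift_by_carrier[OF x(1)] doubled_carrier[OF assms(3)] by (intro eq_vecI) auto
  ultimately show ?thesis using x assms same_coset_iff[of x "x + d"] by (simp add: mem_coset_iff)
qed

lemma half_difference_mem:
  assumes "K \<in> cosets" "x \<in> K" "y \<in> K"
  shows "(1 / 2) \<cdot>\<^sub>v (x - y) \<in> L"
proof -
  have "x \<in> X" "y \<in> X" "coset2 L x = coset2 L y" using assms mem_coset_iff by auto
  then show ?thesis using same_coset_iff[of y x] by (simp add: mem_doubled_iff)
qed

lemma average_mem_X:
  assumes "K \<in> cosets" "x \<in> K" "y \<in> K"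
  shows "(1 / 2) \<cdot>\<^sub>v (x + y) \<in> X"
proof -
  have "x \<in> X" "y \<in> X" using assms coset_subset by auto
  then have "(1 / 2) \<cdot>\<^sub>v (x + y) = y + (1 / 2) \<cdot>\<^sub>v (x - y)"
    using shift_by_carrier by (intro eq_vecI) (auto simp: field_simps dest!: shift_by_carrier)
  then show ?thesis using add_mem_X[OF \<open>y \<in> X\<close> half_difference_mem[OF assms]] by simp
qed

lemma set_average_law: "K \<in> cosets \<Longrightarrow> set_pmf (average_law K) \<subseteq> X"
  by (auto simp: average_law_def set_gaussian_coset s average_mem_X)

text \<open>The rotation \<^term>\<open>(x, y)\<close> to \<^term>\<open>(u, v)\<close> with \<^term>\<open>x = u + v\<close> and \<^term>\<open>y = u - v\<close> turns the
  product of two Gaussians of parameter \<^term>\<open>s\<close> into one of parameter \<^term>\<open>s / sqrt 2\<close>.\<close>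

lemma pmf_average_law:
  assumes K: "K \<in> cosets" and u: "u \<in> X"
  shows "ennreal (pmf (average_law K) u) = (\<integral>\<^sup>+v. ennreal (rho (s / sqrt 2) u *
    (if v \<in> L \<and> u + v \<in> K then rho (s / sqrt 2) v / (rho_set s K)\<^sup>2 else 0)) \<partial>count_space UNIV)"
proof -
  define P where "P = pair_pmf (discrete_gaussian K s) (discrete_gaussian K s)"
  define T where "T = (\<lambda>(x :: real vec, y). ((1 / 2 :: real) \<cdot>\<^sub>v (x + y), (1 / 2 :: real) \<cdot>\<^sub>v (x - y)))"
  have setP: "set_pmf P = K \<times> K" by (simp add: P_def set_gaussian_coset s K)
  have KX: "x \<in> carrier_vec n" if "x \<in> K" for x
    using that coset_subset[OF K] shift_by_carrier by auto
  have T_inv: "x = fst (T (x, y)) + snd (T (x, y))" "y = fst (T (x, y)) - snd (T (x, y))"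
    if "x \<in> carrier_vec n" "y \<in> carrier_vec n" for x y
    unfolding T_def using that by (auto intro!: eq_vecI simp: field_simps)
  have inj: "inj_on T (K \<times> K)"
  proof (rule inj_onI)
    fix a b assume a: "a \<in> K \<times> K" and b: "b \<in> K \<times> K" and eq: "T a = T b"
    show "a = b"
      using a b T_inv[OF KX KX, of "fst a" "snd a"] T_inv[OF KX KX, of "fst b" "snd b"] eq
      by (cases a, cases b) auto
  qed
  have uc: "u \<in> carrier_vec n" using u by (rule shift_by_carrier)
  have "pmf (map_pmf T P) (u, v) = rho (s / sqrt 2) u *
      (if v \<in> L \<and> u + v \<in> K then rho (s / sqrt 2) v / (rho_set s K)\<^sup>2 else 0)" for v
  proof (cases "v \<in> L \<and> u + v \<in> K")
    case True
    then have vc: "v \<in> carrier_vec n" by (simp add: carrier)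
    \<comment> \<open>The second point differs from the first by \<open>2 \<cdot>\<^sub>v v\<close>,
      so the single condition \<open>u + v \<in> K\<close> with \<open>v \<in> L\<close> already
      places both points in \<open>K\<close>.\<close>
    have "u - v \<in> K"
    proof -
      have "- (2 :: real) \<cdot>\<^sub>v v \<in> doubled L"
      proof -
        have "(1 / 2) \<cdot>\<^sub>v (- (2 :: real) \<cdot>\<^sub>v v) = 0\<^sub>v n - v" using vc by (intro eq_vecI) auto
        then show ?thesis using True by (simp add: mem_doubled_iff diff_mem zero_mem)
      qed
      then have "u + v + - (2 :: real) \<cdot>\<^sub>v v \<in> K" using sum_mem_coset[OF K] True by blast
      moreover have "u + v + - (2 :: real) \<cdot>\<^sub>v v = u - v" using uc vc by (intro eq_vecI) auto
      ultimately show ?thesis by simp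
    qed
    then have mem: "(u + v, u - v) \<in> K \<times> K" using True by simp
    have "T (u + v, u - v) = (u, v)"
      unfolding T_def using uc vc by (auto intro!: eq_vecI simp: field_simps)
    then have "pmf (map_pmf T P) (u, v) = pmf P (u + v, u - v)"
      using pmf_map_inj[of T P "(u + v, u - v)"] inj mem by (simp add: setP)
    also have "\<dots> = rho s (u + v) * rho s (u - v) / (rho_set s K)\<^sup>2"
      using mem by (simp add: P_def pmf_pair pmf_gaussian_coset s K power2_eq_square)
    finally show ?thesis using True rho_parallelogram[OF uc vc, of s] by simp
  next
    case False
    have "(u, v) \<notin> T ` set_pmf P"
    proof
      assume "(u, v) \<in> T ` set_pmf P"
      then obtain x y where xy: "x \<in> K" "y \<in> K" "T (x, y) = (u, v)" by (auto simp: setP)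
      then have "x = u + v" using T_inv(1)[OF KX KX, of x y] by simp
      moreover have "v \<in> L" using xy half_difference_mem[OF K xy(1,2)] by (simp add: T_def)
      ultimately show False using False xy by simp
    qed
    then have "pmf (map_pmf T P) (u, v) = 0" by (rule pmf_map_outside)
    then show ?thesis using False by auto
  qed
  then have "(\<integral>\<^sup>+v. ennreal (rho (s / sqrt 2) u *
      (if v \<in> L \<and> u + v \<in> K then rho (s / sqrt 2) v / (rho_set s K)\<^sup>2 else 0)) \<partial>count_space UNIV) =
      (\<integral>\<^sup>+v. ennreal (pmf (map_pmf T P) (u, v)) \<partial>count_space UNIV)"
    by simp
  also have "\<dots> = emeasure (map_pmf T P) (range (Pair u))"
    by (rule nn_integral_pmf') (simp add: inj_on_def)
  also have "\<dots> = emeasure P (T -` range (Pair u))" by simp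
  also have "T -` range (Pair u) = (\<lambda>(x, y). (1 / 2) \<cdot>\<^sub>v (x + y)) -` {u}"
    by (auto simp: T_def)
  also have "emeasure P \<dots> = ennreal (pmf (average_law K) u)"
    unfolding average_law_def P_def[symmetric] pmf_map by (simp add: measure_pmf.emeasure_eq_measure)
  finally show ?thesis by simp
qed

end

section \<open>Lists of independent samples\<close>

lemma set_independent_list:
  "xs \<in> set_pmf (independent_list ps) \<longleftrightarrow> list_all2 (\<lambda>x p. x \<in> set_pmf p) xs ps"
proof (induction ps arbitrary: xs)
  case (Cons p ps)
  then show ?case by (cases xs) auto
qed auto

lemma independent_list_append:
  "independent_list (ps @ qs) =
     bind_pmf (independent_list ps) (\<lambda>xs. bind_pmf (independent_list qs) (\<lambda>ys. return_pmf (xs @ ys)))"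
  by (induction ps) (simp_all add: bind_return_pmf bind_return_pmf' bind_assoc_pmf)

lemma replicate_pmf_eq_independent_list: "replicate_pmf n p = independent_list (replicate n p)"
  by (induction n) simp_all

text \<open>Independence lets all first-stage draws precede all second-stage draws. A list of
  two-stage samples is thereby a list of hidden values, here cosets, followed by independent samples
  given these.\<close>

lemma independent_list_bind:
  "independent_list (map (\<lambda>i. bind_pmf (f i) g) is) =
     bind_pmf (independent_list (map f is)) (\<lambda>ds. independent_list (map g ds))"
proof (induction "is")
  case (Cons i "is")
  have "independent_list (map (\<lambda>i. bind_pmf (f i) g) (i # is)) =
      bind_pmf (f i) (\<lambda>d. bind_pmf (g d) (\<lambda>x. bind_pmf (independent_list (map f is))
        (\<lambda>ds. bind_pmf (independent_list (map g ds)) (\<lambda>xs. return_pmf (x # xs)))))"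
    by (simp add: Cons bind_assoc_pmf)
  also have "\<dots> = bind_pmf (f i) (\<lambda>d. bind_pmf (independent_list (map f is)) (\<lambda>ds. bind_pmf (g d)
        (\<lambda>x. bind_pmf (independent_list (map g ds)) (\<lambda>xs. return_pmf (x # xs)))))"
    by (subst bind_commute_pmf) simp
  also have "\<dots> = bind_pmf (independent_list (map f (i # is))) (\<lambda>ds. independent_list (map g ds))"
    by (simp add: bind_assoc_pmf bind_return_pmf)
  finally show ?case .
qed (simp add: bind_return_pmf)

lemma replicate_pmf_bind:
  "replicate_pmf n (bind_pmf p g) = bind_pmf (replicate_pmf n p) (\<lambda>ds. independent_list (map g ds))"
  using independent_list_bind[of "\<lambda>_. p" g "replicate n ()"]
  by (simp add: replicate_pmf_eq_independent_list map_replicate_const)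

text \<open>Independent draws commute, and the multiset forgets their order, so any chosen law of
  the list may be sampled at the start.\<close>

lemma map_mset_independent_list_remove1:
  assumes "p \<in> set ps"
  shows "map_pmf mset (independent_list ps) =
    bind_pmf p (\<lambda>x. map_pmf (\<lambda>xs. add_mset x (mset xs)) (independent_list (remove1 p ps)))"
  using assms
proof (induction ps)
  case (Cons q ps)
  show ?case
  proof (cases "p = q")
    case True
    then show ?thesis by (simp add: map_bind_pmf map_pmf_def bind_assoc_pmf bind_return_pmf)
  next
    case False
    then have p: "p \<in> set ps" using Cons.prems by simp
    have "map_pmf mset (independent_list (q # ps)) =
        bind_pmf q (\<lambda>y. map_pmf (add_mset y) (map_pmf mset (independent_list ps)))"
      by (simp add: map_bind_pmf pmf.map_comp o_def) (simp add: map_pmf_def)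
    also have "\<dots> = bind_pmf q (\<lambda>y. bind_pmf p (\<lambda>x. bind_pmf (independent_list (remove1 p ps))
        (\<lambda>xs. return_pmf (add_mset y (add_mset x (mset xs))))))"
      unfolding Cons.IH[OF p] by (simp add: map_bind_pmf pmf.map_comp o_def) (simp add: map_pmf_def)
    also have "\<dots> = bind_pmf p (\<lambda>x. bind_pmf q (\<lambda>y. bind_pmf (independent_list (remove1 p ps))
        (\<lambda>xs. return_pmf (add_mset x (add_mset y (mset xs))))))"
      by (subst bind_commute_pmf) (simp add: add_mset_commute)
    also have "\<dots> = bind_pmf p (\<lambda>x. map_pmf (\<lambda>xs. add_mset x (mset xs)) (independent_list (remove1 p (q # ps))))"
      using False by (simp add: map_pmf_def bind_assoc_pmf bind_return_pmf)
    finally show ?thesis .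
  qed
qed simp

text \<open>Further independent draws only raise counts. A law common to both lists is sampled at
  the start in each, which lowers one threshold by 1 in both probabilities; this is why
  \<open>k\<close> varies in the induction.\<close>

lemma emeasure_independent_list_counts_mono:
  assumes "mset ps \<subseteq># mset qs"
  shows "emeasure (independent_list ps) {xs. \<forall>i\<in>S. k i \<le> count_list xs i} \<le>
    emeasure (independent_list qs) {xs. \<forall>i\<in>S. k i \<le> count_list xs i}"
proof -
  have mset: "emeasure (independent_list rs) {xs. \<forall>i\<in>S. k i \<le> count_list xs i} =
      emeasure (map_pmf mset (independent_list rs)) {m. \<forall>i\<in>S. k i \<le> count m i}" for rs :: "'a pmf list" and k
    by (simp add: count_mset vimage_def)
  show ?thesis
    using assms
  proof (induction ps arbitrary: qs k)
    case Nil
    show ?case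
    proof (cases "\<forall>i\<in>S. k i = 0")
      case True
      then show ?thesis by (simp add: measure_pmf.emeasure_space_1[unfolded space_measure_pmf])
    next
      case False
      then show ?thesis by (auto simp: indicator_def)
    qed
  next
    case (Cons p ps)
    then have p: "p \<in> set qs" by (metis insert_subset_eq_iff mset.simps(2) set_mset_mset)
    have sub: "mset ps \<subseteq># mset (remove1 p qs)"
      using Cons.prems by (simp add: insert_subset_eq_iff)
    \<comment> \<open>Truncated subtraction is right here: a threshold that is already 0 stays 0
      after a draw of its value.\<close>
    have eq: "emeasure (map_pmf mset (independent_list rs)) {m. \<forall>i\<in>S. k i \<le> count m i} =
        (\<integral>\<^sup>+x. emeasure (independent_list (remove1 p rs)) {xs. \<forall>i\<in>S. k i - (if i = x then 1 else 0) \<le> count_list xs i} \<partial>p)"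
      if "p \<in> set rs" for rs
    proof -
      have "emeasure (map_pmf mset (independent_list rs)) {m. \<forall>i\<in>S. k i \<le> count m i} =
          (\<integral>\<^sup>+m. indicator {m. \<forall>i\<in>S. k i \<le> count m i} m \<partial>map_pmf mset (independent_list rs))"
        by (simp only: nn_integral_indicator sets_measure_pmf UNIV_I)
      also have "\<dots> = (\<integral>\<^sup>+x. \<integral>\<^sup>+xs. indicator {m. \<forall>i\<in>S. k i \<le> count m i} (add_mset x (mset xs)) \<partial>independent_list (remove1 p rs) \<partial>p)"
        unfolding map_mset_independent_list_remove1[OF that] nn_integral_bind_pmf nn_integral_map_pmf ..
      also have "\<dots> = (\<integral>\<^sup>+x. \<integral>\<^sup>+xs. indicator {xs. \<forall>i\<in>S. k i - (if i = x then 1 else 0) \<le> count_list xs i} xs \<partial>independent_list (remove1 p rs) \<partial>p)"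
        by (intro nn_integral_cong) (auto simp: indicator_def count_mset le_diff_conv split: if_splits)
      finally show ?thesis by simp
    qed
    show ?case
      unfolding mset eq[OF list.set_intros(1)] eq[OF p]
      by (intro nn_integral_mono) (simp only: mset[symmetric] remove1.simps simp_thms if_True, rule Cons.IH[OF sub])
  qed
qed

text \<open>The action of \<^const>\<open>pair_and_average\<close> on the cosets alone.\<close>

function pair_equal :: "'a list \<Rightarrow> 'a list" where
  "pair_equal [] = []"
| "pair_equal (x # xs) = (if x \<in> set xs then x # pair_equal (remove1 x xs) else pair_equal xs)"
  by pat_completeness auto
termination
  by (relation "Wellfounded.measure length") (auto simp: length_remove1)

lemma count_list_remove1: "count_list (remove1 x xs) y = count_list xs y - (if x = y then 1 else 0)"
  by (induction xs) auto

lemma count_list_pair_equal: "count_list (pair_equal xs) c = count_list xs c div 2"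
proof (induction xs rule: pair_equal.induct)
  case (2 x xs)
  show ?case
  proof (cases "x \<in> set xs")
    case True
    then have "0 < count_list xs x" by (metis count_list_0_iff gr0I)
    then show ?thesis using True 2 by (auto simp: count_list_remove1)
  next
    case False
    then show ?thesis using 2 by (auto simp: count_list_0_iff)
  qed
qed simp

lemma set_pair_equal_subset: "set (pair_equal xs) \<subseteq> set xs"
  by (induction xs rule: pair_equal.induct) (auto dest: notin_set_remove1)

section \<open>Averages of pairs\<close>

context gaussian_lattice
begin

text \<open>In the density of the average, the sum over \<open>v\<close> depends on \<open>u\<close>
  only through the condition \<open>u + v \<in> K\<close>, which is invariant under shifts of
  \<open>u\<close> by \<open>doubled L\<close>. That sum is the \<open>\<phi>\<close> of the general
  criterion.\<close>

lemma average_law_mixture: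
  assumes K: "K \<in> cosets"
  shows "bind_pmf (map_pmf (coset2 L) (average_law K)) (\<lambda>D. discrete_gaussian D (s / sqrt 2)) = average_law K"
proof -
  define f where "f u v = (if v \<in> L \<and> u + v \<in> K then rho (s / sqrt 2) v / (rho_set s K)\<^sup>2 else 0)" for u v
  define \<phi> where "\<phi> u = enn2real (\<integral>\<^sup>+v. ennreal (f u v) \<partial>count_space UNIV)" for u
  have f0: "0 \<le> f u v" for u v
    using rho_pos[of "s / sqrt 2" v] by (simp add: f_def)
  show ?thesis
  proof (rule bind_coset_gaussian[OF s' set_average_law[OF K]])
    fix u assume u: "u \<in> X"
    have "ennreal (pmf (average_law K) u) =
        ennreal (rho (s / sqrt 2) u) * (\<integral>\<^sup>+v. ennreal (f u v) \<partial>count_space UNIV)"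
      unfolding pmf_average_law[OF K u] f_def[symmetric]
      using rho_pos[of "s / sqrt 2" u] f0 by (simp add: ennreal_mult' nn_integral_cmult)
    from arg_cong[OF this, of enn2real] show "pmf (average_law K) u = rho (s / sqrt 2) u * \<phi> u"
      using rho_pos[of "s / sqrt 2" u] by (simp add: enn2real_mult \<phi>_def)
  next
    fix u u' assume u: "u \<in> X" "u' \<in> X" "coset2 L u = coset2 L u'"
    have shift: "u' + v \<in> K" if "u + v \<in> K" "v \<in> L" "u \<in> X" "u' \<in> X" "coset2 L u = coset2 L u'" for u u' v
    proof -
      have "u' - u \<in> doubled L" using same_coset_iff[OF that(3,4)] that(5) by simp
      then have "u + v + (u' - u) \<in> K" by (rule sum_mem_coset[OF K that(1)])
      moreover have "u + v + (u' - u) = u' + v"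
        using shift_by_carrier[OF that(3)] shift_by_carrier[OF that(4)] carrier[OF that(2)] by (intro eq_vecI) auto
      ultimately show ?thesis by simp
    qed
    have "f u = f u'"
      unfolding f_def using shift[of u _ u'] shift[of u' _ u] u by (auto simp: fun_eq_iff)
    then show "\<phi> u = \<phi> u'" by (simp add: \<phi>_def)
  qed
qed

lemma rho_summable_on_L: "r > 0 \<Longrightarrow> rho r summable_on L"
proof -
  assume r: "r > 0"
  interpret Z: gaussian_lattice n L "0\<^sub>v n" s
    by unfold_locales (use s in auto)
  have "shift_by L (0\<^sub>v n) = L"
    by (auto simp: Z.mem_shift_by_iff carrier)
  with Z.rho_summable_on_shift[OF r] show ?thesis by simp
qed

text \<open>Both laws are proportional to \<^term>\<open>rho (s / sqrt 2)\<close> on \<^term>\<open>X\<close>, hence equal; comparing the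
  constants gives the collision mass \<^term>\<open>W\<close>.\<close>

lemma bind_collision_average_law:
  assumes w: "\<And>K. pmf w K = (if K \<in> cosets then (rho_set s K)\<^sup>2 / W else 0)" and W: "W > 0"
  shows "bind_pmf w average_law = discrete_gaussian X (s / sqrt 2)"
    "W = rho_set (s / sqrt 2) X * rho_set (s / sqrt 2) L"
proof -
  let ?r = "rho (s / sqrt 2)"
  define c where "c = rho_set (s / sqrt 2) X * rho_set (s / sqrt 2) L / W"
  have setw: "set_pmf w \<subseteq> cosets" by (auto simp: set_pmf_iff w split: if_splits)
  have L_pos: "0 < rho_set (s / sqrt 2) L"
    by (rule rho_set_pos[OF rho_summable_on_L[OF s']]) (use zero_mem in auto)
  have eq: "pmf (bind_pmf w average_law) u = c * pmf (discrete_gaussian X (s / sqrt 2)) u" for u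
  proof (cases "u \<in> X")
    case False
    then have "u \<notin> set_pmf (bind_pmf w average_law)"
      using setw set_average_law by auto
    then show ?thesis using False by (simp add: pmf_gaussian_X[OF s'] pmf_eq_0_set_pmf)
  next
    case True
    \<comment> \<open>The weight of \<open>K\<close> under \<open>w\<close> cancels the squared mass
      in the law of the average, and each \<open>u + v\<close> lies in exactly one coset. Summing
      over \<open>K\<close> therefore removes the only dependence on \<open>u\<close> besides
      \<open>?r u\<close>.\<close>
    have rest: "(\<Sum>K\<in>cosets. if v \<in> L \<and> u + v \<in> K then ?r v / W else 0) = (if v \<in> L then ?r v / W else 0)" for v
    proof (cases "v \<in> L")
      case v: True
      have uv: "u + v \<in> X" using True v by (rule add_mem_X)
      have "(\<Sum>K\<in>cosets. if v \<in> L \<and> u + v \<in> K then ?r v / W else 0) =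
          (\<Sum>K\<in>cosets. if K = coset2 L (u + v) then ?r v / W else 0)"
        by (intro sum.cong refl) (use v uv in \<open>auto simp: mem_coset_iff\<close>)
      then show ?thesis using v uv finite_cosets coset2_mem_cosets by simp
    qed simp
    have "ennreal (pmf (bind_pmf w average_law) u) = (\<integral>\<^sup>+K. ennreal (pmf (average_law K) u) \<partial>w)"
      by (rule ennreal_pmf_bind)
    also have "\<dots> = (\<Sum>K\<in>cosets. ennreal (pmf (average_law K) u) * ennreal (pmf w K))"
      by (rule nn_integral_measure_pmf_support[OF finite_cosets]) (use setw in auto)
    also have "\<dots> = (\<Sum>K\<in>cosets. \<integral>\<^sup>+v. ennreal (?r u * (if v \<in> L \<and> u + v \<in> K then ?r v / W else 0)) \<partial>count_space UNIV)"
    proof (rule sum.cong[OF refl])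
      fix K assume K: "K \<in> cosets"
      show "ennreal (pmf (average_law K) u) * ennreal (pmf w K) =
          (\<integral>\<^sup>+v. ennreal (?r u * (if v \<in> L \<and> u + v \<in> K then ?r v / W else 0)) \<partial>count_space UNIV)"
        unfolding pmf_average_law[OF K True] using K W rho_set_coset_pos[OF s K] rho_pos
        by (subst nn_integral_multc[symmetric])
           (auto intro!: nn_integral_cong simp: w ennreal_mult'[symmetric] less_imp_le)
    qed
    also have "\<dots> = (\<integral>\<^sup>+v. (\<Sum>K\<in>cosets. ennreal (?r u * (if v \<in> L \<and> u + v \<in> K then ?r v / W else 0))) \<partial>count_space UNIV)"
      by (rule nn_integral_sum[symmetric]) simp
    also have "\<dots> = (\<integral>\<^sup>+v. ennreal (?r u * (\<Sum>K\<in>cosets. if v \<in> L \<and> u + v \<in> K then ?r v / W else 0)) \<partial>count_space UNIV)"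
      unfolding sum_distrib_left using W rho_pos
      by (subst sum_ennreal) (auto intro!: mult_nonneg_nonneg simp: less_imp_le)
    also have "\<dots> = (\<integral>\<^sup>+v. ennreal (?r v * (?r u / W)) \<partial>count_space L)"
      unfolding rest by (subst (2) nn_integral_count_space_indicator) (auto intro!: nn_integral_cong simp: indicator_def mult.commute)
    also have "\<dots> = ennreal (infsum (\<lambda>v. ?r v * (?r u / W)) L)"
      using W rho_pos by (intro nn_integral_count_space_infsum summable_on_cmult_left rho_summable_on_L s')
        (auto intro!: mult_nonneg_nonneg divide_nonneg_pos simp: less_imp_le)
    also have "infsum (\<lambda>v. ?r v * (?r u / W)) L = rho_set (s / sqrt 2) L * (?r u / W)"
      unfolding rho_set_def by (intro infsum_cmult_left rho_summable_on_L s')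
    finally have "pmf (bind_pmf w average_law) u = rho_set (s / sqrt 2) L * (?r u / W)"
      using W rho_pos[of "s / sqrt 2" u] L_pos
      by (subst (asm) ennreal_inj) (auto intro!: mult_nonneg_nonneg divide_nonneg_pos simp: less_imp_le)
    then show ?thesis
      using True rho_set_X_pos[OF s'] by (simp add: pmf_gaussian_X[OF s'] c_def)
  qed
  show "bind_pmf w average_law = discrete_gaussian X (s / sqrt 2)"
    by (rule pmf_proportional(1)[OF eq])
  have "c = 1" by (rule pmf_proportional(2)[OF eq])
  then show "W = rho_set (s / sqrt 2) X * rho_set (s / sqrt 2) L"
    using W by (simp add: c_def)
qed

lemma pmf_coset_law:
  "pmf (map_pmf (coset2 L) (discrete_gaussian X s)) K = (if K \<in> cosets then rho_set s K / rho_set s X else 0)"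
proof (cases "K \<in> cosets")
  case True
  have "pmf (map_pmf (coset2 L) (discrete_gaussian X s)) K = measure (discrete_gaussian X s) (coset2 L -` {K})"
    by (rule pmf_map)
  also have "\<dots> = measure (discrete_gaussian X s) K"
    by (rule measure_pmf.finite_measure_eq_AE)
       (auto simp: AE_measure_pmf_iff set_gaussian_X[OF s] mem_coset_iff[OF True])
  also have "\<dots> = infsum (\<lambda>x. rho s x * (1 / rho_set s X)) K"
    unfolding infsum_pmf[symmetric]
    by (rule infsum_cong) (use coset_subset[OF True] in \<open>auto simp: pmf_gaussian_X[OF s]\<close>)
  also have "\<dots> = rho_set s K * (1 / rho_set s X)"
    unfolding rho_set_def by (intro infsum_cmult_left rho_summable_on_coset s True)
  finally show ?thesis using True by simp
next
  case False
  then have "K \<notin> set_pmf (map_pmf (coset2 L) (discrete_gaussian X s))"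
    using coset2_mem_cosets by (auto simp: set_gaussian_X[OF s])
  then show ?thesis using False by (simp add: pmf_eq_0_set_pmf)
qed

lemma bind_coset_law: "bind_pmf (map_pmf (coset2 L) (discrete_gaussian X s)) (\<lambda>K. discrete_gaussian K s) = discrete_gaussian X s"
  by (rule bind_coset_gaussian[OF s, where \<phi> = "\<lambda>_. 1 / rho_set s X"])
     (auto simp: set_gaussian_X[OF s] pmf_gaussian_X[OF s])

lemma map_coset2_gaussian_list:
  assumes r: "r > 0" and "set Ks \<subseteq> cosets" and "xs \<in> set_pmf (independent_list (map (\<lambda>K. discrete_gaussian K r) Ks))"
  shows "map (coset2 L) xs = Ks" "set xs \<subseteq> X"
proof -
  have "list_all2 (\<lambda>x K. x \<in> K) xs Ks"
    using assms(2,3) unfolding set_independent_list list_all2_map2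
    by (auto simp: list_all2_conv_all_nth set_gaussian_coset[OF r] subset_iff)
  then show "map (coset2 L) xs = Ks" "set xs \<subseteq> X"
    using assms(2) by (induction) (auto simp: mem_coset_iff)
qed

text \<open>A sample drawn for the cosets \<open>Ks\<close> has exactly these cosets, so the hidden
  list can be read off the outcome and conditioning on it recovers the Gaussian factor.\<close>

lemma gaussian_mixture_bind:
  fixes R :: "real vec set list pmf"
  assumes r: "r > 0" and R: "set_pmf R \<subseteq> lists cosets"
  shows "gaussian_mixture L t r (bind_pmf R (\<lambda>Ks. independent_list (map (\<lambda>K. discrete_gaussian K r) Ks)))"
    "coset_distribution L (bind_pmf R (\<lambda>Ks. independent_list (map (\<lambda>K. discrete_gaussian K r) Ks))) = R"
proof -
  let ?I = "\<lambda>Ks. independent_list (map (\<lambda>K. discrete_gaussian K r) Ks)"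
  let ?P = "bind_pmf R ?I"
  have "set Ks \<subseteq> cosets" if "Ks \<in> set_pmf R" for Ks
    using R that by blast
  note I = map_coset2_gaussian_list[OF r this]
  have "coset_distribution L ?P = bind_pmf R (\<lambda>Ks. bind_pmf (?I Ks) (\<lambda>xs. return_pmf (map (coset2 L) xs)))"
    unfolding coset_distribution_def map_bind_pmf by (simp add: map_pmf_def)
  also have "\<dots> = bind_pmf R (\<lambda>Ks. bind_pmf (?I Ks) (\<lambda>xs. return_pmf Ks))"
    by (intro bind_pmf_cong refl) (simp add: I(1))
  finally show cd: "coset_distribution L ?P = R"
    by (simp add: bind_return_pmf')
  show "gaussian_mixture L t r ?P"
    unfolding gaussian_mixture_def cd
  proof (intro conjI ballI)
    show "set_pmf ?P \<subseteq> lists X" using I(2) by (fastforce simp: in_lists_conv_set)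
    fix Ks assume Ks: "Ks \<in> set_pmf R"
    have ne: "set_pmf ?P \<inter> {xs. map (coset2 L) xs = Ks} \<noteq> {}"
    proof -
      obtain xs where "xs \<in> set_pmf (?I Ks)" using set_pmf_not_empty by fast
      then show ?thesis using Ks I(1)[OF Ks] by auto
    qed
    have pP: "pmf ?P xs = pmf R Ks * pmf (?I Ks) xs" if "map (coset2 L) xs = Ks" for xs
    proof -
      have "ennreal (pmf ?P xs) = (\<integral>\<^sup>+Ks'. ennreal (pmf (?I Ks) xs) * indicator {Ks} Ks' \<partial>R)"
        unfolding ennreal_pmf_bind
      proof (intro nn_integral_cong_AE AE_pmfI)
        fix Ks' assume Ks': "Ks' \<in> set_pmf R"
        show "ennreal (pmf (?I Ks') xs) = ennreal (pmf (?I Ks) xs) * indicator {Ks} Ks'"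
          using I(1)[OF Ks', of xs] that by (cases "Ks' = Ks") (auto simp: pmf_eq_0_set_pmf)
      qed
      also have "\<dots> = ennreal (pmf (?I Ks) xs) * ennreal (pmf R Ks)"
        by (subst nn_integral_cmult) (auto simp: emeasure_pmf_single)
      finally show ?thesis by (simp add: ennreal_mult'[symmetric] mult.commute)
    qed
    show "cond_pmf ?P {xs. map (coset2 L) xs = Ks} = ?I Ks"
    proof (rule pmf_proportional(1))
      fix xs
      show "pmf (cond_pmf ?P {xs. map (coset2 L) xs = Ks}) xs =
          pmf R Ks / measure ?P {xs. map (coset2 L) xs = Ks} * pmf (?I Ks) xs"
        using pP I(1)[OF Ks, of xs] by (cases "map (coset2 L) xs = Ks") (auto simp: pmf_cond[OF ne] pmf_eq_0_set_pmf)
    qed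
  qed
qed

text \<open>With the cosets fixed, which positions are paired is no longer random. The partner of
  the head sits at the next occurrence of its coset; its draw commutes with those in between, so the
  pair contributes one average independent of all remaining entries.\<close>

lemma pair_and_average_independent:
  "set Ks \<subseteq> cosets \<Longrightarrow> map_pmf (pair_and_average L) (independent_list (map (\<lambda>K. discrete_gaussian K s) Ks)) =
     independent_list (map average_law (pair_equal Ks))"
proof (induction Ks rule: pair_equal.induct)
  case 1
  show ?case by simp
next
  case (2 K Ks)
  let ?I = "\<lambda>Ks. independent_list (map (\<lambda>K. discrete_gaussian K s) Ks)"
  have K: "K \<in> cosets" using 2 by simp
  have mem: "list_all2 (\<lambda>x K. x \<in> K) xs Js" if "xs \<in> set_pmf (?I Js)" "set Js \<subseteq> cosets" for xs Js
    using that unfolding set_independent_list list_all2_map2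
    by (auto simp: list_all2_conv_all_nth set_gaussian_coset[OF s] subset_iff)
  have apart: "y - x \<notin> doubled L"
    if "x \<in> K" "xs \<in> set_pmf (?I Js)" "set Js \<subseteq> cosets" "K \<notin> set Js" "y \<in> set xs" for x xs y Js
  proof -
    have "map (coset2 L) xs = Js" "set xs \<subseteq> X"
      using map_coset2_gaussian_list[OF s that(3,2)] by auto
    then have "coset2 L y \<noteq> K" "y \<in> X" using that by auto
    then show ?thesis using that(1) by (simp add: mem_coset_iff[OF K] same_coset_iff)
  qed
  show ?case
  proof (cases "K \<in> set Ks")
    case False
    have "map_pmf (pair_and_average L) (?I (K # Ks)) =
        bind_pmf (discrete_gaussian K s) (\<lambda>x. bind_pmf (?I Ks) (\<lambda>xs. return_pmf (pair_and_average L (x # xs))))"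
      by (simp add: map_bind_pmf)
    also have "\<dots> = bind_pmf (discrete_gaussian K s) (\<lambda>x. bind_pmf (?I Ks) (\<lambda>xs. return_pmf (pair_and_average L xs)))"
    proof (intro bind_pmf_cong refl arg_cong[where f = return_pmf])
      fix x xs assume x: "x \<in> set_pmf (discrete_gaussian K s)" and xs: "xs \<in> set_pmf (?I Ks)"
      have "find (\<lambda>y. y - x \<in> doubled L) xs = None"
        unfolding find_None_iff using apart[OF _ xs] x 2(3) False by (auto simp: set_gaussian_coset[OF s K])
      then show "pair_and_average L (x # xs) = pair_and_average L xs" by simp
    qed
    also have "\<dots> = map_pmf (pair_and_average L) (?I Ks)"
      by (simp add: map_pmf_def)
    finally show ?thesis using 2 False by simp
  next
    case True
    then obtain As Bs where split: "Ks = As @ K # Bs" "K \<notin> set As"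
      using split_list_first by metis
    have sub: "set As \<subseteq> cosets" "set Bs \<subseteq> cosets" using 2(3) split by auto
    have rem: "remove1 K Ks = As @ Bs" using split by (simp add: remove1_append)
    let ?avg = "\<lambda>x y. (1 / 2) \<cdot>\<^sub>v (x + y)"
    have "map_pmf (pair_and_average L) (?I (K # Ks)) =
        bind_pmf (discrete_gaussian K s) (\<lambda>x. bind_pmf (?I As) (\<lambda>as. bind_pmf (discrete_gaussian K s)
          (\<lambda>y. bind_pmf (?I Bs) (\<lambda>bs. return_pmf (pair_and_average L (x # as @ y # bs))))))"
      unfolding split by (simp add: map_bind_pmf independent_list_append bind_assoc_pmf bind_return_pmf)
    also have "\<dots> = bind_pmf (discrete_gaussian K s) (\<lambda>x. bind_pmf (?I As) (\<lambda>as. bind_pmf (discrete_gaussian K s)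
          (\<lambda>y. bind_pmf (?I Bs) (\<lambda>bs. return_pmf (?avg x y # pair_and_average L (as @ bs))))))"
    proof (intro bind_pmf_cong refl arg_cong[where f = return_pmf])
      fix x as y bs
      assume x: "x \<in> set_pmf (discrete_gaussian K s)" and as: "as \<in> set_pmf (?I As)"
        and y: "y \<in> set_pmf (discrete_gaussian K s)"
      have xy: "x \<in> K" "y \<in> K" using x y by (auto simp: set_gaussian_coset[OF s K])
      have as_apart: "z - x \<notin> doubled L" if "z \<in> set as" for z
        using apart[OF xy(1) as sub(1) split(2) that] .
      have yx: "y - x \<in> doubled L" using xy by (simp add: mem_coset_iff[OF K] same_coset_iff)
      have "find (\<lambda>z. z - x \<in> doubled L) (as @ y # bs) = Some y"
        using as_apart yx by (induction as) auto
      \<comment> \<open>Removal by value deletes this very position: an earlier entry equal to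
        \<open>y\<close> would lie in the coset of \<open>x\<close>.\<close>
      moreover have "remove1 y (as @ y # bs) = as @ bs"
        using as_apart yx by (auto simp: remove1_append)
      ultimately show "pair_and_average L (x # as @ y # bs) = ?avg x y # pair_and_average L (as @ bs)"
        by simp
    qed
    also have "\<dots> = bind_pmf (discrete_gaussian K s) (\<lambda>x. bind_pmf (discrete_gaussian K s)
          (\<lambda>y. bind_pmf (?I As) (\<lambda>as. bind_pmf (?I Bs) (\<lambda>bs. return_pmf (?avg x y # pair_and_average L (as @ bs))))))"
      by (subst bind_commute_pmf) simp
    also have "\<dots> = bind_pmf (average_law K) (\<lambda>u. bind_pmf (map_pmf (pair_and_average L) (?I (As @ Bs))) (\<lambda>us. return_pmf (u # us)))"
      by (simp add: average_law_def bind_map_pmf pair_pmf_def bind_assoc_pmf bind_return_pmf independent_list_append)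
    also have "\<dots> = independent_list (map average_law (pair_equal (K # Ks)))"
      using 2(1)[OF True] True sub by (simp add: rem)
    finally show ?thesis .
  qed
qed

end

section \<open>Domination for the list of averages\<close>

lemma collision_pmf_exists:
  assumes fin: "finite (set_pmf p)"
  shows "\<exists>w. \<forall>c. pmf w c = (pmf p c)\<^sup>2 / (\<Sum>c\<in>set_pmf p. (pmf p c)\<^sup>2)"
proof -
  define q where "q = (\<Sum>c\<in>set_pmf p. (pmf p c)\<^sup>2)"
  have q: "q > 0"
    unfolding q_def using fin set_pmf_not_empty[of p] by (intro sum_pos) (auto simp: set_pmf_iff)
  have "(\<integral>\<^sup>+c. ennreal ((pmf p c)\<^sup>2 / q) \<partial>count_space UNIV) = (\<Sum>c\<in>set_pmf p. ennreal ((pmf p c)\<^sup>2 / q))"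
    by (rule nn_integral_count_space'[OF fin]) (auto simp: set_pmf_iff)
  also have "\<dots> = 1"
    using q by (subst sum_ennreal) (auto simp: q_def simp flip: sum_divide_distrib)
  finally have "\<forall>c. pmf (embed_pmf (\<lambda>c. (pmf p c)\<^sup>2 / q)) c = (pmf p c)\<^sup>2 / q"
    using q by (intro allI pmf_embed_pmf) auto
  then show ?thesis unfolding q_def by blast
qed

lemma statistical_distance_le_1: "statistical_distance P Q \<le> 1"
proof -
  have "statistical_distance (map_pmf fst (pair_pmf P Q)) (map_pmf snd (pair_pmf P Q)) \<le>
      measure (pair_pmf P Q) {(x, y). x \<noteq> y}"
    by (rule statistical_distance_le_coupling)
  also have "\<dots> \<le> 1" by (rule measure_pmf.prob_le_1)
  finally show ?thesis by (simp add: map_fst_pair_pmf map_snd_pair_pmf)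
qed

lemma dominates_return_Nil: "dominates S P (return_pmf [])"
  unfolding dominates_def by (auto simp: indicator_def)

context gaussian_lattice
begin

lemma max_coset_mass_eq: "max_coset_mass L t s = Max (rho_set s ` cosets)"
  unfolding max_coset_mass_def shifted_quotient2_def image_image ..

text \<open>Each average is a two-stage sample: the coset of the average, in general different from
  the coset \<open>K\<close> of its inputs, and a Gaussian on it. Moving all coset draws to the
  front exhibits the whole list as a mixture.\<close>

lemma averages_mixture:
  assumes R: "set_pmf R \<subseteq> lists cosets"
  shows "gaussian_mixture L t (s / sqrt 2) (bind_pmf R (\<lambda>Ks. independent_list (map average_law Ks)))"
    and "coset_distribution L (bind_pmf R (\<lambda>Ks. independent_list (map average_law Ks))) =
      bind_pmf R (\<lambda>Ks. independent_list (map (\<lambda>K. map_pmf (coset2 L) (average_law K)) Ks))"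
proof -
  let ?\<alpha> = "\<lambda>K. map_pmf (coset2 L) (average_law K)"
  let ?R = "bind_pmf R (\<lambda>Ks. independent_list (map ?\<alpha> Ks))"
  have P: "bind_pmf R (\<lambda>Ks. independent_list (map average_law Ks)) = bind_pmf ?R (\<lambda>Ds. independent_list (map (\<lambda>D. discrete_gaussian D (s / sqrt 2)) Ds))"
    unfolding bind_assoc_pmf independent_list_bind[symmetric]
  proof (intro bind_pmf_cong refl arg_cong[where f = independent_list] map_cong)
    fix Ks K assume "Ks \<in> set_pmf R" "K \<in> set Ks"
    then have "K \<in> cosets" using R by blast
    then show "average_law K = bind_pmf (?\<alpha> K) (\<lambda>D. discrete_gaussian D (s / sqrt 2))"
      by (rule average_law_mixture[symmetric])
  qed
  have "set_pmf ?R \<subseteq> lists cosets"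
  proof
    fix Ds assume Ds: "Ds \<in> set_pmf ?R"
    obtain Ks where Ks: "Ks \<in> set_pmf R" "list_all2 (\<lambda>D K. D \<in> set_pmf (?\<alpha> K)) Ds Ks"
      using Ds by (auto simp: set_independent_list list_all2_map2)
    then have "\<forall>K\<in>set Ks. set_pmf (?\<alpha> K) \<subseteq> cosets"
      using R Ks(1) set_average_law coset2_mem_cosets by (fastforce simp: subset_iff)
    with Ks(2) show "Ds \<in> lists cosets" by induction auto
  qed
  from gaussian_mixture_bind[OF s' this]
  show "gaussian_mixture L t (s / sqrt 2) (bind_pmf R (\<lambda>Ks. independent_list (map average_law Ks)))"
    "coset_distribution L (bind_pmf R (\<lambda>Ks. independent_list (map average_law Ks))) = ?R"
    unfolding P by blast+
qed

text \<open>Drawing the input cosets before the inputs separates the two sources of randomness: the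
  pairing depends only on the former, and given it the averages are independent.\<close>

lemma pair_and_average_output:
  "map_pmf (pair_and_average L) (replicate_pmf M (discrete_gaussian X s)) =
    bind_pmf (map_pmf pair_equal (replicate_pmf M (map_pmf (coset2 L) (discrete_gaussian X s))))
      (\<lambda>Ks. independent_list (map average_law Ks))"
proof -
  let ?p = "map_pmf (coset2 L) (discrete_gaussian X s)"
  have "map_pmf (pair_and_average L) (replicate_pmf M (discrete_gaussian X s)) =
      bind_pmf (replicate_pmf M ?p) (\<lambda>Ks. map_pmf (pair_and_average L) (independent_list (map (\<lambda>K. discrete_gaussian K s) Ks)))"
    by (subst bind_coset_law[symmetric]) (simp only: replicate_pmf_bind map_bind_pmf)
  also have "\<dots> = bind_pmf (replicate_pmf M ?p) (\<lambda>Ks. independent_list (map average_law (pair_equal Ks)))"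
  proof (intro bind_pmf_cong refl pair_and_average_independent)
    fix Ks assume "Ks \<in> set_pmf (replicate_pmf M ?p)"
    then show "set Ks \<subseteq> cosets"
      using coset2_mem_cosets by (auto simp: set_replicate_pmf set_gaussian_X[OF s])
  qed
  finally show ?thesis by (simp add: bind_map_pmf)
qed

lemma set_paired_cosets:
  "set_pmf (map_pmf pair_equal (replicate_pmf M (map_pmf (coset2 L) (discrete_gaussian X s)))) \<subseteq> lists cosets"
proof -
  have "set (pair_equal Ks) \<subseteq> cosets" if "set Ks \<subseteq> coset2 L ` X" for Ks
    using that set_pair_equal_subset[of Ks] coset2_mem_cosets by blast
  then show ?thesis
    by (auto simp: set_replicate_pmf set_gaussian_X[OF s] in_lists_conv_set subset_iff)
qed

lemma pair_and_average_dominates: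
  fixes M :: nat and \<kappa> :: real
  assumes kappa: "\<kappa> \<ge> 100" "\<kappa> \<ge> 16 * ln (real M)"
    and M: "real M \<ge> 10 * \<kappa>\<^sup>2 * (rho_set s X / max_coset_mass L t s)"
  defines "M' \<equiv> nat \<lceil>real M / (32 * \<kappa>) *
    (rho_set (s / sqrt 2) X * rho_set (s / sqrt 2) L / (rho_set s X * max_coset_mass L t s))\<rceil>"
  shows "mixture_dominates_upto (exp (- \<kappa> / 32)) L t (s / sqrt 2)
    (map_pmf (pair_and_average L) (replicate_pmf M (discrete_gaussian X s)))
    (replicate_pmf M' (discrete_gaussian X (s / sqrt 2)))"
proof -
  define p where "p = map_pmf (coset2 L) (discrete_gaussian X s)"
  define mm where "mm = max_coset_mass L t s"
  define W where "W = (\<Sum>K\<in>cosets. (rho_set s K)\<^sup>2)"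
  define q where "q = (\<Sum>K\<in>set_pmf p. (pmf p K)\<^sup>2)"
  have XP: "0 < rho_set s X" by (rule rho_set_X_pos[OF s])
  have pmf_p: "pmf p K = (if K \<in> cosets then rho_set s K / rho_set s X else 0)" for K
    unfolding p_def by (rule pmf_coset_law)
  have setp: "set_pmf p = cosets"
    using XP less_imp_neq[OF rho_set_coset_pos[OF s]] by (auto simp: set_pmf_iff pmf_p split: if_splits)
  have fin: "finite (set_pmf p)" by (simp add: setp finite_cosets)
  have mm_ge: "rho_set s K \<le> mm" if "K \<in> cosets" for K
    unfolding mm_def max_coset_mass_eq using that finite_cosets by simp
  have "mm \<in> rho_set s ` cosets"
    unfolding mm_def max_coset_mass_eq using finite_cosets cosets_nonempty by (intro Max_in) auto
  then obtain K0 where K0: "K0 \<in> cosets" "mm = rho_set s K0" by blast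
  have mm0: "mm > 0" using K0 rho_set_coset_pos[OF s] by simp
  have W0: "W > 0"
    unfolding W_def using finite_cosets cosets_nonempty less_imp_neq[OF rho_set_coset_pos[OF s]]
    by (intro sum_pos) auto
  have q: "q = W / (rho_set s X)\<^sup>2"
    unfolding q_def W_def setp sum_divide_distrib by (intro sum.cong) (auto simp: pmf_p power_divide)
  obtain w where w: "\<And>K. pmf w K = (pmf p K)\<^sup>2 / q"
    using collision_pmf_exists[OF fin] unfolding q_def by blast
  have wW: "pmf w K = (if K \<in> cosets then (rho_set s K)\<^sup>2 / W else 0)" for K
    using XP by (simp add: w q pmf_p power_divide)
  note collision = bind_collision_average_law[OF wW W0]
  have setw: "set_pmf w \<subseteq> cosets" by (auto simp: set_pmf_iff wW split: if_splits)
  have p_le: "pmf p K \<le> mm / rho_set s X" for K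
    using mm_ge[of K] XP mm0 by (auto simp: pmf_p intro: divide_right_mono)
  have p_K0: "pmf p K0 = mm / rho_set s X"
    using K0 by (simp add: pmf_p)
  have M1: "real M \<ge> 10 * \<kappa>\<^sup>2 / (mm / rho_set s X)"
    using M by (simp add: mm_def)
  \<comment> \<open>The collision probability \<open>q\<close> over the largest coset probability is
    \<open>W / (rho_set s X * mm)\<close>; evaluating \<open>W\<close> as a product of two Gaussian
    sums yields the fraction in \<open>M'\<close>.\<close>
  have M2: "M' = nat \<lceil>real M / (32 * \<kappa>) * (q / (mm / rho_set s X))\<rceil>"
    unfolding M'_def mm_def[symmetric] collision(2)[symmetric] q
    using XP by (simp add: power2_eq_square)
  obtain J where J: "map_pmf snd J = replicate_pmf M' w"
      "\<And>V U. (V, U) \<in> set_pmf J \<Longrightarrow> set V \<subseteq> set U"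
      "measure J {(V, U). V \<noteq> U} \<le> exp (- \<kappa> / 32)"
    and dom: "\<And>F G :: real vec set list \<Rightarrow> ennreal.
       (\<And>V Ks. (\<forall>c. count_list V c \<le> count_list Ks c div 2) \<Longrightarrow> F V \<le> G Ks) \<Longrightarrow>
       (\<integral>\<^sup>+x. F (fst x) \<partial>J) \<le> (\<integral>\<^sup>+Ks. G Ks \<partial>replicate_pmf M p)"
    using pairs_dominate_collision_samples[OF fin kappa p_le p_K0 M1 q_def w M2] by blast
  define A where "A Ks = independent_list (map average_law Ks)" for Ks
  define Q' where "Q' = bind_pmf J (\<lambda>x. A (fst x))"
  let ?Q = "replicate_pmf M' (discrete_gaussian X (s / sqrt 2))"
  let ?out = "map_pmf (pair_and_average L) (replicate_pmf M (discrete_gaussian X s))"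
  have Q: "?Q = bind_pmf J (\<lambda>x. A (snd x))"
    unfolding collision(1)[symmetric] replicate_pmf_bind J(1)[symmetric] bind_map_pmf A_def ..
  have Q'_eq: "Q' = bind_pmf (map_pmf fst J) (\<lambda>Ks. independent_list (map average_law Ks))"
    unfolding Q'_def A_def bind_map_pmf ..
  have J_cosets: "set_pmf (map_pmf fst J) \<subseteq> lists cosets"
  proof
    fix V assume "V \<in> set_pmf (map_pmf fst J)"
    then have "V \<in> fst ` set_pmf J" by simp
    then obtain U where VU: "(V, U) \<in> set_pmf J" by force
    then have "U \<in> set_pmf (map_pmf snd J)" by force
    then have "set U \<subseteq> cosets" using setw unfolding J(1) by (auto simp: set_replicate_pmf)
    with J(2)[OF VU] show "V \<in> lists cosets" by blast
  qed
  note mix = averages_mixture[OF J_cosets]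
  have out_cosets: "set_pmf (map_pmf pair_equal (replicate_pmf M p)) \<subseteq> lists cosets"
    unfolding p_def by (rule set_paired_cosets)
  have "statistical_distance Q' ?Q \<le> exp (- \<kappa> / 32)"
    unfolding Q Q'_def by (rule order_trans[OF statistical_distance_bind_le J(3)])
  moreover have "gaussian_mixture L t (s / sqrt 2) Q'"
    unfolding Q'_eq by (rule mix(1))
  moreover have "mixture_dominates L t ?out Q'"
    unfolding mixture_dominates_def dominates_def
  proof
    fix k :: "real vec set \<Rightarrow> nat"
    let ?E = "{xs. \<forall>i\<in>cosets. k i \<le> count_list xs i}"
    let ?\<alpha> = "\<lambda>K. map_pmf (coset2 L) (average_law K)"
    \<comment> \<open>The functions fed to \<open>dom\<close> are the probabilities, given a list of
      input cosets, that the cosets of the averages meet the thresholds \<open>k\<close>.\<close>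
    have "emeasure (coset_distribution L Q') ?E = (\<integral>\<^sup>+x. emeasure (independent_list (map ?\<alpha> (fst x))) ?E \<partial>J)"
      unfolding Q'_eq mix(2) emeasure_bind_pmf by simp
    also have "\<dots> \<le> (\<integral>\<^sup>+Ks. emeasure (independent_list (map ?\<alpha> (pair_equal Ks))) ?E \<partial>replicate_pmf M p)"
    proof (rule dom)
      fix V Ks :: "real vec set list"
      assume "\<forall>c. count_list V c \<le> count_list Ks c div 2"
      then have "mset V \<subseteq># mset (pair_equal Ks)"
        by (simp add: subseteq_mset_def count_mset count_list_pair_equal)
      then have "mset (map ?\<alpha> V) \<subseteq># mset (map ?\<alpha> (pair_equal Ks))"
        unfolding mset_map by (rule image_mset_subseteq_mono)
      then show "emeasure (independent_list (map ?\<alpha> V)) ?E \<le> emeasure (independent_list (map ?\<alpha> (pair_equal Ks))) ?E"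
        by (rule emeasure_independent_list_counts_mono)
    qed
    also have "\<dots> = emeasure (coset_distribution L ?out) ?E"
      unfolding pair_and_average_output p_def[symmetric] averages_mixture(2)[OF out_cosets] emeasure_bind_pmf by simp
    finally show "measure (coset_distribution L Q') ?E \<le> measure (coset_distribution L ?out) ?E"
      by (simp add: measure_pmf.emeasure_eq_measure)
  qed
  ultimately show ?thesis
    unfolding mixture_dominates_upto_def by blast
qed

lemma pair_and_average_mixture:
  "gaussian_mixture L t (s / sqrt 2) (map_pmf (pair_and_average L) (replicate_pmf M (discrete_gaussian X s)))"
  unfolding pair_and_average_output
  by (rule averages_mixture(1)[OF set_paired_cosets])

lemma mixture_dominates_upto_1: "mixture_dominates_upto 1 L t (s / sqrt 2) P Q"
proof -
  have "gaussian_mixture L t (s / sqrt 2) (return_pmf [])"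
    using gaussian_mixture_bind(1)[OF s', of "return_pmf []"] by (simp add: bind_return_pmf)
  moreover have "mixture_dominates L t P (return_pmf [])"
    by (simp add: mixture_dominates_def coset_distribution_def dominates_return_Nil)
  ultimately show ?thesis
    unfolding mixture_dominates_upto_def using statistical_distance_le_1 by blast
qed

end

theorem theoremB1:
  shows "\<exists>C > 0. \<exists>g :: real \<Rightarrow> real. (\<forall>\<kappa>. g \<kappa> \<ge> 0) \<and> g \<in> \<Omega>(\<lambda>\<kappa>. \<kappa>) \<and>
    (\<forall>(n::nat) (L :: real vec set) (t :: real vec) (s::real) (M::nat) (\<kappa>::real).
       is_lattice n L \<longrightarrow> t \<in> carrier_vec n \<longrightarrow> s > 0 \<longrightarrow>
       \<kappa> \<ge> C * ln (real M) \<longrightarrow>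
       real M \<ge> 10 * \<kappa>\<^sup>2 * (rho_set s (shift_by L t) / max_coset_mass L t s) \<longrightarrow>
       (let output = map_pmf (pair_and_average L) (replicate_pmf M (discrete_gaussian (shift_by L t) s));
            M' = nat \<lceil>real M / (32 * \<kappa>) *
                   (rho_set (s / sqrt 2) (shift_by L t) * rho_set (s / sqrt 2) L /
                    (rho_set s (shift_by L t) * max_coset_mass L t s))\<rceil>
        in gaussian_mixture L t (s / sqrt 2) output \<and>
           mixture_dominates_upto (exp (- g \<kappa>)) L t (s / sqrt 2) output
             (replicate_pmf M' (discrete_gaussian (shift_by L t) (s / sqrt 2)))))"
proof -
  define g where "g \<kappa> = (if \<kappa> \<ge> 100 then \<kappa> / 32 else 0)" for \<kappa> :: real
  have g_Omega: "g \<in> \<Omega>(\<lambda>\<kappa>. \<kappa>)"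
  proof (rule landau_omega.bigI[of "1 / 32"])
    show "\<forall>\<^sub>F \<kappa> in at_top. 1 / 32 * norm \<kappa> \<le> norm (g \<kappa>)"
      using eventually_ge_at_top[of 100] by eventually_elim (simp add: g_def)
  qed simp
  have g_nonneg: "0 \<le> g \<kappa>" for \<kappa> by (simp add: g_def)
  have main: "let output = map_pmf (pair_and_average L) (replicate_pmf M (discrete_gaussian (shift_by L t) s));
            M' = nat \<lceil>real M / (32 * \<kappa>) *
                   (rho_set (s / sqrt 2) (shift_by L t) * rho_set (s / sqrt 2) L /
                    (rho_set s (shift_by L t) * max_coset_mass L t s))\<rceil>
        in gaussian_mixture L t (s / sqrt 2) output \<and>
           mixture_dominates_upto (exp (- g \<kappa>)) L t (s / sqrt 2) output
             (replicate_pmf M' (discrete_gaussian (shift_by L t) (s / sqrt 2)))"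
    if lat: "is_lattice n L" and t: "t \<in> carrier_vec n" and s: "s > 0"
      and kappa: "\<kappa> \<ge> 16 * ln (real M)"
      and M: "real M \<ge> 10 * \<kappa>\<^sup>2 * (rho_set s (shift_by L t) / max_coset_mass L t s)"
    for n :: nat and L :: "real vec set" and t :: "real vec" and s :: real and M :: nat and \<kappa> :: real
  proof -
    interpret gaussian_lattice n L t s
      by unfold_locales (use lat t s in auto)
    show ?thesis
      unfolding Let_def
      using pair_and_average_mixture pair_and_average_dominates[OF _ kappa M] mixture_dominates_upto_1
      \<comment> \<open>The case \<open>\<kappa> < 100\<close> includes
        \<open>\<kappa> \<le> 0\<close>; there the error allowed is \<open>exp 0 = 1\<close>, for
        which the comparison holds whatever the value of \<open>M'\<close>.\<close>
      by (cases "\<kappa> \<ge> 100") (simp_all add: g_def)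
  qed
  show ?thesis
  proof (intro exI[of _ "16 :: real"] exI[of _ g] conjI allI impI)
    show "0 < (16 :: real)" by simp
  qed (rule g_nonneg g_Omega main; assumption)+
qed

end
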